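(* \textsc{FreeGame}$_\varepsilon$ is solvable in time $n^{O(\varepsilon^{-2}\log n)}$. In more detail, given as input a description of a free game $G=(X,Y,A,B,V)$, there is a randomized algorithm running in time $|X|\cdot|A|^{O(\varepsilon^{-2}\log(|Y||B|))}$ that estimates $\omega(G)$ to within additive error $\pm\varepsilon$ with success probability at least $2/3$, and there is a deterministic algorithm that does so in time $(|X||A|)^{O(\varepsilon^{-2}\log(|Y||B|))}$.
   Context: A free game $G=(X,Y,A,B,V)$ consists of finite sets $X,Y,A,B$ and $V:X\times Y\times A\times B\to[0,1]$ (given explicitly as a table); its value is $\omega(G)=\max_{a:X\to A,b:Y\to B}\mathbb{E}_{x\in X,y\in Y}[V(x,y,a(x),b(y))]$ with $x,y$ independent uniform. \textsc{FreeGame}$_\varepsilon$: given such a $G$ (input size $n=|X||Y||A||B|$), estimate $\omega(G)$ to within $\pm\varepsilon$.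
   Formalization: In the time bounds the bases n, |A|, |X||A| and the log arguments n, |Y||B| are read as at least 2 (and O(.) allows a constant factor): literally, for |X|=|Y|=|A|=1 the bound is constant, though about |B| table entries must be read. *)

theory Defs
  imports "HOL-Probability.Probability"
begin

section \<open>Free games\<close>

text \<open>A game is given as an explicit table, so the elements of the four finite sets
  are the indices below the respective sizes.  Values of \<open>payoff\<close> outside this range
  are irrelevant.\<close>

record free_game =
  nX :: nat
  nY :: nat
  nA :: nat
  nB :: nat
  payoff :: "nat \<Rightarrow> nat \<Rightarrow> nat \<Rightarrow> nat \<Rightarrow> real"

definition is_free_game :: "free_game \<Rightarrow> bool" where
  "is_free_game G \<longleftrightarrow> nX G > 0 \<and> nY G > 0 \<and> nA G > 0 \<and> nB G > 0 \<and>
     (\<forall>x<nX G. \<forall>y<nY G. \<forall>a<nA G. \<forall>b<nB G. payoff G x y a b \<in> {0..1})"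

definition input_size :: "free_game \<Rightarrow> nat" where
  "input_size G = nX G * nY G * nA G * nB G"

definition win_expectation :: "free_game \<Rightarrow> (nat \<Rightarrow> nat) \<Rightarrow> (nat \<Rightarrow> nat) \<Rightarrow> real" where
  "win_expectation G a b =
     measure_pmf.expectation (pair_pmf (pmf_of_set {..<nX G}) (pmf_of_set {..<nY G}))
       (\<lambda>(x, y). payoff G x y (a x) (b y))"

definition game_value :: "free_game \<Rightarrow> real" where
  "game_value G = Max {win_expectation G a b | a b.
     a \<in> {..<nX G} \<rightarrow>\<^sub>E {..<nA G} \<and> b \<in> {..<nY G} \<rightarrow>\<^sub>E {..<nB G}}"

section \<open>Probabilistic random access programs\<close>

text \<open>The state consists of two unbounded, indirectly addressable memories, one for natural
  numbers (indices, counters) and one for real numbers (accumulated payoffs).  The game itself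
  is a read-only table.  Every instruction and every test takes one step.  There is no
  unit-cost multiplication, no rounding from reals to naturals, and reals can only be
  divided by naturals; hence, from table entries of polynomial bit length, no numbers of
  superpolynomial bit length arise in polynomially many steps.\<close>

datatype instr =
    NConst nat nat
  | NMove nat nat
  | NAdd nat nat nat
  | NSub nat nat nat
  | NLoad nat nat
  | NStore nat nat
  | Rand nat nat
  | ROfNat nat nat
  | RMove nat nat
  | RAdd nat nat nat
  | RSub nat nat nat
  | RDivNat nat nat nat
  | RLoad nat nat
  | RStore nat nat
  | Query nat nat nat nat nat

datatype test = NLess nat nat | RLess nat nat

datatype com =
    Skip
  | Do instr
  | Seq com com
  | IfThenElse test com com
  | While test com

record state =
  nmem :: "nat \<Rightarrow> nat"
  rmem :: "nat \<Rightarrow> real"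

abbreviation set_nmem :: "state \<Rightarrow> nat \<Rightarrow> nat \<Rightarrow> state" where
  "set_nmem s i v \<equiv> s\<lparr>nmem := (nmem s)(i := v)\<rparr>"

abbreviation set_rmem :: "state \<Rightarrow> nat \<Rightarrow> real \<Rightarrow> state" where
  "set_rmem s i v \<equiv> s\<lparr>rmem := (rmem s)(i := v)\<rparr>"

definition table_entry :: "free_game \<Rightarrow> nat \<Rightarrow> nat \<Rightarrow> nat \<Rightarrow> nat \<Rightarrow> real" where
  "table_entry G x y a b =
     (if x < nX G \<and> y < nY G \<and> a < nA G \<and> b < nB G then payoff G x y a b else 0)"

text \<open>The first argument of an instruction is the target address, except for \<open>NStore\<close> and
  \<open>RStore\<close>, where it is the address of the cell that holds the target address.
  \<open>Rand i j\<close> draws uniformly from the naturals below the content of cell \<open>j\<close>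
  (and yields 0 if that content is 0).\<close>

fun exec_instr :: "free_game \<Rightarrow> instr \<Rightarrow> state \<Rightarrow> state pmf" where
  "exec_instr G (NConst i k) s = return_pmf (set_nmem s i k)"
| "exec_instr G (NMove i j) s = return_pmf (set_nmem s i (nmem s j))"
| "exec_instr G (NAdd i j k) s = return_pmf (set_nmem s i (nmem s j + nmem s k))"
| "exec_instr G (NSub i j k) s = return_pmf (set_nmem s i (nmem s j - nmem s k))"
| "exec_instr G (NLoad i j) s = return_pmf (set_nmem s i (nmem s (nmem s j)))"
| "exec_instr G (NStore i j) s = return_pmf (set_nmem s (nmem s i) (nmem s j))"
| "exec_instr G (Rand i j) s = map_pmf (set_nmem s i) (pmf_of_set {..<max 1 (nmem s j)})"
| "exec_instr G (ROfNat i j) s = return_pmf (set_rmem s i (real (nmem s j)))"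
| "exec_instr G (RMove i j) s = return_pmf (set_rmem s i (rmem s j))"
| "exec_instr G (RAdd i j k) s = return_pmf (set_rmem s i (rmem s j + rmem s k))"
| "exec_instr G (RSub i j k) s = return_pmf (set_rmem s i (rmem s j - rmem s k))"
| "exec_instr G (RDivNat i j k) s = return_pmf (set_rmem s i (rmem s j / real (nmem s k)))"
| "exec_instr G (RLoad i j) s = return_pmf (set_rmem s i (rmem s (nmem s j)))"
| "exec_instr G (RStore i j) s = return_pmf (set_rmem s (nmem s i) (rmem s j))"
| "exec_instr G (Query i x y a b) s =
     return_pmf (set_rmem s i (table_entry G (nmem s x) (nmem s y) (nmem s a) (nmem s b)))"

fun holds :: "test \<Rightarrow> state \<Rightarrow> bool" where
  "holds (NLess i j) s \<longleftrightarrow> nmem s i < nmem s j"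
| "holds (RLess i j) s \<longleftrightarrow> rmem s i < rmem s j"

text \<open>A configuration is the stack of commands still to be executed together with the state;
  it is final when the stack is empty.\<close>

type_synonym config = "com list \<times> state"

fun step :: "free_game \<Rightarrow> config \<Rightarrow> config pmf" where
  "step G ([], s) = return_pmf ([], s)"
| "step G (Skip # cs, s) = return_pmf (cs, s)"
| "step G (Do i # cs, s) = map_pmf (Pair cs) (exec_instr G i s)"
| "step G (Seq c d # cs, s) = return_pmf (c # d # cs, s)"
| "step G (IfThenElse t c d # cs, s) = return_pmf ((if holds t s then c else d) # cs, s)"
| "step G (While t c # cs, s) = return_pmf (if holds t s then c # While t c # cs else cs, s)"

fun steps :: "free_game \<Rightarrow> nat \<Rightarrow> config \<Rightarrow> config pmf" where
  "steps G 0 c = return_pmf c"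
| "steps G (Suc t) c = bind_pmf (step G c) (steps G t)"

definition initial_state :: "free_game \<Rightarrow> state" where
  "initial_state G =
     \<lparr>nmem = (\<lambda>_. 0)(0 := nX G, 1 := nY G, 2 := nA G, 3 := nB G), rmem = (\<lambda>_. 0)\<rparr>"

definition run :: "com \<Rightarrow> free_game \<Rightarrow> nat \<Rightarrow> config pmf" where
  "run P G t = steps G t ([P], initial_state G)"

definition halted :: "config \<Rightarrow> bool" where
  "halted c \<longleftrightarrow> fst c = []"

definition result :: "config \<Rightarrow> real" where
  "result c = rmem (snd c) 0"

fun deterministic :: "com \<Rightarrow> bool" where
  "deterministic Skip \<longleftrightarrow> True"
| "deterministic (Do i) \<longleftrightarrow> (\<nexists>j k. i = Rand j k)"
| "deterministic (Seq c d) \<longleftrightarrow> deterministic c \<and> deterministic d"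
| "deterministic (IfThenElse t c d) \<longleftrightarrow> deterministic c \<and> deterministic d"
| "deterministic (While t c) \<longleftrightarrow> deterministic c"

text \<open>The time bound must hold for all outcomes of the random choices.\<close>

definition estimates_value_within ::
    "com \<Rightarrow> free_game \<Rightarrow> real \<Rightarrow> real \<Rightarrow> real \<Rightarrow> bool" where
  "estimates_value_within P G T \<epsilon> p \<longleftrightarrow>
     (\<exists>t. real t \<le> T \<and> (\<forall>c \<in> set_pmf (run P G t). halted c) \<and>
       measure_pmf.prob (run P G t) {c. \<bar>result c - game_value G\<bar> \<le> \<epsilon>} \<ge> p)"

definition solves_deterministically ::
    "com \<Rightarrow> real \<Rightarrow> (free_game \<Rightarrow> real) \<Rightarrow> bool" where
  "solves_deterministically P \<epsilon> T \<longleftrightarrow> deterministic P \<and>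
     (\<forall>G. is_free_game G \<longrightarrow> estimates_value_within P G (T G) \<epsilon> 1)"

definition solves_randomized ::
    "com \<Rightarrow> real \<Rightarrow> (free_game \<Rightarrow> real) \<Rightarrow> bool" where
  "solves_randomized P \<epsilon> T \<longleftrightarrow>
     (\<forall>G. is_free_game G \<longrightarrow> estimates_value_within P G (T G) \<epsilon> (2/3))"

section \<open>Time bounds\<close>

text \<open>In a bound \<open>M\<^sup>O\<^sup>(\<^sup>q\<^sup>)\<close> the base and the argument of the logarithm are understood
  to be at least 2.  Taken literally the bounds degenerate otherwise: for a single answer
  \<open>|A| = 1\<close>, say, \<open>|X| \<cdot> |A|\<^sup>O\<^sup>(\<^sup>q\<^sup>)\<close> would not depend on \<open>|Y|\<close> and \<open>|B|\<close>.\<close>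

definition at_least_2 :: "nat \<Rightarrow> real" where
  "at_least_2 m = real (max 2 m)"

definition quasipoly_time :: "real \<Rightarrow> real \<Rightarrow> free_game \<Rightarrow> real" where
  "quasipoly_time C \<epsilon> G =
     C * at_least_2 (input_size G) powr (C * log 2 (at_least_2 (input_size G)) / \<epsilon>\<^sup>2)"

definition randomized_time :: "real \<Rightarrow> real \<Rightarrow> free_game \<Rightarrow> real" where
  "randomized_time C \<epsilon> G =
     C * real (nX G) * at_least_2 (nA G) powr (C * log 2 (at_least_2 (nY G * nB G)) / \<epsilon>\<^sup>2)"

definition deterministic_time :: "real \<Rightarrow> real \<Rightarrow> free_game \<Rightarrow> real" where
  "deterministic_time C \<epsilon> G =
     C * at_least_2 (nX G * nA G) powr (C * log 2 (at_least_2 (nY G * nB G)) / \<epsilon>\<^sup>2)"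

end

theory Submission
  imports Defs "HOL-Probability.Hoeffding"
begin

text \<open>Fix an optimal strategy \<open>a\<close> of the first player and draw
  \<open>m = O(\<epsilon>\<^sup>-\<^sup>2 log(|Y||B|))\<close> questions \<open>x\<^sub>1, \<dots>, x\<^sub>m\<close> independently.  By Hoeffding's inequality and a
  union bound over the pairs \<open>(y, b)\<close>, with probability at least 2/3 each sample mean of
  \<open>V(x\<^sub>i, y, a(x\<^sub>i), b)\<close> is within \<open>\<epsilon>/2\<close> of its expectation, so that answering every \<open>y\<close> optimally
  against the sample alone loses at most \<open>\<epsilon>\<close>.  The answers \<open>a(x\<^sub>i)\<close> are not known, but one can try all
  \<open>|A|\<^sup>m\<close> guesses for them: each guess determines a strategy of the second player, whose value
  against the best strategy of the first player never exceeds \<open>\<omega>(G)\<close>, and one of the guesses achieves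
  \<open>\<omega>(G) - \<epsilon>\<close>.  The deterministic algorithm tries all samples as well.  For \<open>\<epsilon> \<ge> 1\<close> the answer 0 is
  good enough.\<close>

section \<open>Hoeffding's inequality for independent samples\<close>

text \<open>The machine shapes the proof: it has no multiplication, logarithm or rounding, and
  \<epsilon> is not among its inputs. So each \<epsilon> < 1 gets its own pair of programs, with
  \<open>K\<close> = \<lceil>8/\<epsilon>^2\<rceil> written in as a constant. They compute
  \<open>m = K * Suc l\<close> at run time by counting doublings, where 2^l lies between |Y||B| and
  4|Y||B|. As the nesting depth of loops cannot depend on \<open>m\<close>, guesses are enumerated
  by a mixed-radix counter in memory. Both programs share this search and differ only in which
  digits it advances.

  The result never exceeds \<omega>(G), whatever the sample, because each candidate is the value of
  a genuine pair of strategies. Only the lower bound needs a good sample: the randomized program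
  draws one with probability 2/3, and the deterministic program uses merely that one exists.

  The case \<epsilon> \<ge> 1 is separate because for large \<epsilon> the exponent of the time
  bound is close to 0, and the bound may fall below the cost of testing a single guess.\<close>

lemma nn_integral_exp_sum_list_replicate_pmf:
  fixes f :: "'a \<Rightarrow> real"
  shows "(\<integral>\<^sup>+xs. ennreal (exp (sum_list (map f xs))) \<partial>replicate_pmf n p) =
    (\<integral>\<^sup>+x. ennreal (exp (f x)) \<partial>p) ^ n"
proof (induction n)
  case (Suc n)
  show ?case
    by (simp add: exp_add ennreal_mult nn_integral_cmult nn_integral_multc Suc mult.commute)
qed simp

text \<open>Chernoff's method: by independence the exponential moment of the sum is a power of that
  of one term, which Hoeffding's lemma bounds; Markov's inequality gives the tail.\<close>

lemma Hoeffding_replicate_pmf_ge: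
  fixes f :: "'a \<Rightarrow> real"
  assumes f: "\<And>x. f x \<in> {0..1}" and \<delta>: "\<delta> > 0"
  shows "measure_pmf.prob (replicate_pmf n p)
     {xs. sum_list (map (\<lambda>x. f x - measure_pmf.expectation p f) xs) \<ge> real n * \<delta>}
       \<le> exp (- 2 * real n * \<delta>\<^sup>2)" (is "measure_pmf.prob ?P {xs. ?S xs \<ge> _} \<le> _")
proof -
  define g where "g x = f x - measure_pmf.expectation p f" for x
  interpret interval_bounded_random_variable "measure_pmf p" f 0 1
    by unfold_locales (use f in auto)
  \<comment> \<open>The parameter t = 4\<delta> minimises t^2/8 - t\<delta>; the minimum
    -2\<delta>^2 is the exponent of the claim.\<close>
  have "(\<integral>\<^sup>+x. ennreal (exp (4 * \<delta> * g x)) \<partial>p) \<le> ennreal (exp ((4 * \<delta>)\<^sup>2 * (1 - 0)\<^sup>2 / 8))"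
    unfolding g_def by (rule Hoeffdings_lemma_nn_integral) (use \<delta> in auto)
  then have mgf: "(\<integral>\<^sup>+x. ennreal (exp (4 * \<delta> * g x)) \<partial>p) \<le> ennreal (exp (2 * \<delta>\<^sup>2))"
    by (simp add: power_mult_distrib)
  have "emeasure ?P {xs. ?S xs \<ge> real n * \<delta>}
      = (\<integral>\<^sup>+xs. indicator {xs. ?S xs \<ge> real n * \<delta>} xs \<partial>?P)"
    by simp
  also have "\<dots> \<le> (\<integral>\<^sup>+xs. ennreal (exp (- 4 * real n * \<delta>\<^sup>2)) *
      ennreal (exp (sum_list (map (\<lambda>x. 4 * \<delta> * g x) xs))) \<partial>?P)"
  \<comment> \<open>Markov's inequality pointwise: on the event, exp (4\<delta>(S - n\<delta>)) is
    at least 1.\<close>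
  proof (intro nn_integral_mono)
    fix xs
    have "1 \<le> ennreal (exp (- 4 * real n * \<delta>\<^sup>2)) * ennreal (exp (4 * \<delta> * ?S xs))"
      if "?S xs \<ge> real n * \<delta>"
    proof -
      have "4 * \<delta> * ?S xs \<ge> 4 * \<delta> * (real n * \<delta>)"
        using that \<delta> by (intro mult_left_mono) auto
      then show ?thesis
        by (simp flip: ennreal_mult exp_add ennreal_1 add: power2_eq_square mult_ac)
    qed
    then show "indicator {xs. ?S xs \<ge> real n * \<delta>} xs \<le> ennreal (exp (- 4 * real n * \<delta>\<^sup>2)) *
      ennreal (exp (sum_list (map (\<lambda>x. 4 * \<delta> * g x) xs)))"
      by (auto simp: sum_list_const_mult g_def split: split_indicator)
  qed
  also have "\<dots> = ennreal (exp (- 4 * real n * \<delta>\<^sup>2)) * (\<integral>\<^sup>+x. ennreal (exp (4 * \<delta> * g x)) \<partial>p) ^ n"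
    by (simp add: nn_integral_cmult nn_integral_exp_sum_list_replicate_pmf)
  also have "\<dots> \<le> ennreal (exp (- 4 * real n * \<delta>\<^sup>2)) * ennreal (exp (2 * \<delta>\<^sup>2)) ^ n"
    by (intro mult_left_mono power_mono mgf) auto
  also have "\<dots> = ennreal (exp (- 2 * real n * \<delta>\<^sup>2))"
    by (simp add: ennreal_power flip: ennreal_mult exp_add exp_of_nat_mult)
  finally show ?thesis
    by (simp add: measure_pmf.emeasure_eq_measure)
qed

text \<open>The lower tail of \<open>f\<close> is the upper tail of \<open>1 - f\<close>, which also
  takes values in the unit interval; hence the factor 2.\<close>

lemma Hoeffding_replicate_pmf_abs_ge:
  fixes f :: "'a \<Rightarrow> real"
  assumes f: "\<And>x. f x \<in> {0..1}" and \<delta>: "\<delta> > 0"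
  shows "measure_pmf.prob (replicate_pmf n p)
     {xs. \<bar>sum_list (map (\<lambda>x. f x - measure_pmf.expectation p f) xs)\<bar> \<ge> real n * \<delta>}
       \<le> 2 * exp (- 2 * real n * \<delta>\<^sup>2)"
proof -
  let ?E = "measure_pmf.expectation p"
  have int: "integrable (measure_pmf p) f"
    using f by (intro measure_pmf.integrable_const_bound[where B = 1]) auto
  have "?E (\<lambda>x. 1 - f x) = 1 - ?E f"
    using int by simp
  then have *: "sum_list (map (\<lambda>x. (1 - f x) - ?E (\<lambda>x. 1 - f x)) xs) =
      - sum_list (map (\<lambda>x. f x - ?E f) xs)" for xs
    by (induction xs) auto
  have "{xs. \<bar>sum_list (map (\<lambda>x. f x - ?E f) xs)\<bar> \<ge> real n * \<delta>} \<subseteq>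
    {xs. sum_list (map (\<lambda>x. f x - ?E f) xs) \<ge> real n * \<delta>} \<union>
    {xs. sum_list (map (\<lambda>x. (1 - f x) - ?E (\<lambda>x. 1 - f x)) xs) \<ge> real n * \<delta>}"
    unfolding * by (auto simp: abs_if split: if_splits)
  then have "measure_pmf.prob (replicate_pmf n p)
     {xs. \<bar>sum_list (map (\<lambda>x. f x - ?E f) xs)\<bar> \<ge> real n * \<delta>} \<le>
     measure_pmf.prob (replicate_pmf n p) ({xs. sum_list (map (\<lambda>x. f x - ?E f) xs) \<ge> real n * \<delta>} \<union>
    {xs. sum_list (map (\<lambda>x. (1 - f x) - ?E (\<lambda>x. 1 - f x)) xs) \<ge> real n * \<delta>})"
    by (intro measure_pmf.finite_measure_mono) auto
  also have "\<dots> \<le> measure_pmf.prob (replicate_pmf n p) {xs. sum_list (map (\<lambda>x. f x - ?E f) xs) \<ge> real n * \<delta>} +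
    measure_pmf.prob (replicate_pmf n p) {xs. sum_list (map (\<lambda>x. (1 - f x) - ?E (\<lambda>x. 1 - f x)) xs) \<ge> real n * \<delta>}"
    by (intro measure_Un_le) auto
  also have "\<dots> \<le> exp (- 2 * real n * \<delta>\<^sup>2) + exp (- 2 * real n * \<delta>\<^sup>2)"
    by (intro add_mono Hoeffding_replicate_pmf_ge) (use f \<delta> in auto)
  finally show ?thesis by simp
qed

section \<open>Time-bounded weakest preconditions\<close>

lemma steps_halted [simp]: "steps G n ([], s) = return_pmf ([], s)"
  by (induction n) (auto simp: bind_return_pmf)

lemma steps_add: "steps G (m + n) c = bind_pmf (steps G m c) (steps G n)"
proof (induction m arbitrary: c)
  case (Suc m)
  then have "steps G (m + n) = (\<lambda>c. bind_pmf (steps G m c) (steps G n))"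
    by (intro ext)
  then show ?case
    by (cases c) (simp add: bind_assoc_pmf)
qed (simp add: bind_return_pmf)

text \<open>Total correctness with a time bound, for runs with a single outcome. Choosing
  \<open>k\<close> and \<open>s'\<close> before the rest \<open>cs\<close> of the stack makes the
  notion compose, and \<open>k \<le> n\<close> lets bounds be rounded up. The drawing of questions
  does not fit this scheme and is analysed directly through \<open>steps\<close>.\<close>

definition wp :: "free_game \<Rightarrow> com \<Rightarrow> nat \<Rightarrow> (state \<Rightarrow> bool) \<Rightarrow> state \<Rightarrow> bool" where
  "wp G c n Q s \<longleftrightarrow>
     (\<exists>k\<le>n. \<exists>s'. (\<forall>cs. steps G k (c # cs, s) = return_pmf (cs, s')) \<and> Q s')"

lemma wpI:
  assumes "\<And>cs. steps G k (c # cs, s) = return_pmf (cs, s')" "k \<le> n" "Q s'"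
  shows "wp G c n Q s"
  using assms unfolding wp_def by blast

lemma wpE:
  assumes "wp G c n Q s"
  obtains k s' where "\<forall>cs. steps G k (c # cs, s) = return_pmf (cs, s')" "k \<le> n" "Q s'"
  using assms unfolding wp_def by blast

lemma wp_mono:
  assumes "wp G c n Q s" "n \<le> n'" "\<And>s'. Q s' \<Longrightarrow> Q' s'"
  shows "wp G c n' Q' s"
  using assms unfolding wp_def by (meson order_trans)

lemma wp_Skip: "Q s \<Longrightarrow> wp G Skip 1 Q s"
  by (rule wpI[where k = 1]) (auto simp: bind_return_pmf)

lemma wp_Do: "exec_instr G i s = return_pmf s' \<Longrightarrow> Q s' \<Longrightarrow> wp G (Do i) 1 Q s"
  by (rule wpI[where k = 1]) (auto simp: bind_return_pmf)

lemma wp_Seq: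
  assumes "wp G c m (wp G d n Q) s"
  shows "wp G (Seq c d) (Suc (m + n)) Q s"
proof -
  from assms obtain k s' where k: "\<forall>cs. steps G k (c # cs, s) = return_pmf (cs, s')" "k \<le> m"
    "wp G d n Q s'" by (rule wpE)
  from k(3) obtain l s'' where l: "\<forall>cs. steps G l (d # cs, s') = return_pmf (cs, s'')" "l \<le> n"
    "Q s''" by (rule wpE)
  show ?thesis
    by (rule wpI[where k = "Suc (k + l)"]) (use k l in \<open>auto simp: bind_return_pmf steps_add\<close>)
qed

lemma wp_If:
  assumes "holds t s \<Longrightarrow> wp G c n Q s" "\<not> holds t s \<Longrightarrow> wp G d n Q s"
  shows "wp G (IfThenElse t c d) (Suc n) Q s"
proof -
  have "wp G (if holds t s then c else d) n Q s" using assms by auto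
  then obtain k s' where
    k: "\<forall>cs. steps G k ((if holds t s then c else d) # cs, s) = return_pmf (cs, s')" "k \<le> n" "Q s'"
    by (rule wpE)
  show ?thesis
    by (rule wpI[where k = "Suc k"]) (use k in \<open>auto simp: bind_return_pmf\<close>)
qed

text \<open>The invariant carries the number \<open>v\<close> of rounds still allowed. A passing
  test forces \<open>v\<close> to be a successor, so \<open>v = 0\<close> forces exit. Each round
  pays one step for its test, and the failing test is the final step.\<close>

lemma wp_While:
  assumes "I v s"
    and "\<And>v s. I v s \<Longrightarrow> holds t s \<Longrightarrow> \<exists>u. v = Suc u \<and> wp G c n (I u) s"
    and "\<And>v s. I v s \<Longrightarrow> \<not> holds t s \<Longrightarrow> Q s"
  shows "wp G (While t c) (v * Suc n + 1) Q s"
  using assms(1)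
proof (induction v arbitrary: s)
  case 0
  then have "\<not> holds t s" using assms(2) by blast
  then show ?case
    by (intro wpI[where k = 1]) (use 0 assms(3) in \<open>auto simp: bind_return_pmf\<close>)
next
  case (Suc v)
  show ?case
  proof (cases "holds t s")
    case True
    with assms(2)[OF Suc.prems] have "wp G c n (I v) s" by auto
    then obtain k s' where k: "\<forall>cs. steps G k (c # cs, s) = return_pmf (cs, s')" "k \<le> n" "I v s'"
      by (rule wpE)
    from Suc.IH[OF k(3)] obtain l s'' where
      l: "\<forall>cs. steps G l (While t c # cs, s') = return_pmf (cs, s'')" "l \<le> v * Suc n + 1" "Q s''"
      by (rule wpE)
    show ?thesis
      by (rule wpI[where k = "Suc (k + l)"])
         (use k l True in \<open>auto simp: bind_return_pmf steps_add\<close>)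
  next
    case False
    then show ?thesis
      by (intro wpI[where k = 1]) (use Suc.prems assms(3) in \<open>auto simp: bind_return_pmf\<close>)
  qed
qed

section \<open>Straight-line code and counting loops\<close>

definition det_exec :: "free_game \<Rightarrow> instr \<Rightarrow> state \<Rightarrow> state" where
  "det_exec G i s = (THE s'. exec_instr G i s = return_pmf s')"

lemma det_execI: "exec_instr G i s = return_pmf s' \<Longrightarrow> det_exec G i s = s'"
  by (simp add: det_exec_def)

lemmas det_exec_simps [simp] = exec_instr.simps(1-6,8-15)[THEN det_execI]

definition block :: "instr list \<Rightarrow> com" where
  "block is = foldr (\<lambda>i. Seq (Do i)) is Skip"

definition is_det :: "instr \<Rightarrow> bool" where
  "is_det i \<longleftrightarrow> (\<nexists>j k. i = Rand j k)"

lemma is_det_simps [simp]: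
  "is_det (NConst i k)" "is_det (NMove i j)" "is_det (NAdd i j k)" "is_det (NSub i j k)"
  "is_det (NLoad i j)" "is_det (NStore i j)" "is_det (ROfNat i j)" "is_det (RMove i j)"
  "is_det (RAdd i j k)" "is_det (RSub i j k)" "is_det (RDivNat i j k)" "is_det (RLoad i j)"
  "is_det (RStore i j)" "is_det (Query i x y a b)"
  by (simp_all add: is_det_def)

lemma deterministic_block [simp]: "deterministic (block is) \<longleftrightarrow> (\<forall>i\<in>set is. is_det i)"
  by (induction "is") (auto simp: block_def is_det_def)

lemma exec_instr_det: "is_det i \<Longrightarrow> exec_instr G i s = return_pmf (det_exec G i s)"
  by (cases i) (auto simp: is_det_def)

text \<open>Each instruction costs two steps, one of them for splitting the \<open>Seq\<close>; the
  closing \<open>Skip\<close> costs one.\<close>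

lemma steps_block:
  assumes "\<forall>i\<in>set is. is_det i"
  shows "steps G (2 * length is + 1) (block is # cs, s) =
    return_pmf (cs, fold (det_exec G) is s)"
  using assms
proof (induction "is" arbitrary: s)
  case (Cons i "is")
  have "steps G (2 * length (i # is) + 1) (block (i # is) # cs, s) =
    steps G (2 * length is + 1) (block is # cs, det_exec G i s)"
    using Cons.prems by (simp add: block_def bind_return_pmf exec_instr_det)
  then show ?case using Cons by simp
qed (simp add: block_def bind_return_pmf)

lemma wp_block:
  assumes "\<forall>i\<in>set is. is_det i" "Q (fold (det_exec G) is s)"
  shows "wp G (block is) (2 * length is + 1) Q s"
  by (rule wpI[where k = "2 * length is + 1"]) (use assms steps_block in auto)

lemma wp_If_block:
  assumes "\<forall>i\<in>set is \<union> set js. is_det i"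
    and "holds t s \<Longrightarrow> Q (fold (det_exec G) is s)"
    and "\<not> holds t s \<Longrightarrow> Q (fold (det_exec G) js s)"
  shows "wp G (IfThenElse t (block is) (block js)) (2 * (length is + length js) + 2) Q s"
proof -
  have "wp G (block is) (2 * (length is + length js) + 1) Q s" if "holds t s"
    by (rule wp_mono[OF wp_block]) (use assms that in auto)
  moreover have "wp G (block js) (2 * (length is + length js) + 1) Q s" if "\<not> holds t s"
    by (rule wp_mono[OF wp_block]) (use assms that in auto)
  ultimately show ?thesis
    using wp_If[of t s G "block is" "2 * (length is + length js) + 1" Q "block js"] by simp
qed

text \<open>Cell 4 is assumed to hold the constant 1.\<close>

definition for_loop :: "nat \<Rightarrow> nat \<Rightarrow> com \<Rightarrow> com" where
  "for_loop i j c = Seq (Do (NConst i 0)) (While (NLess i j) (Seq c (Do (NAdd i i 4))))"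

lemma deterministic_for_loop [simp]: "deterministic (for_loop i j c) \<longleftrightarrow> deterministic c"
  by (simp add: for_loop_def)

text \<open>The invariant is asked of the state with the counter already advanced, so it may freely
  mention the counter cell. A round adds three steps to the body: test, \<open>Seq\<close> and
  increment. The last three steps are the outer \<open>Seq\<close>, the initialisation and the
  failing test.\<close>

lemma wp_for_loop:
  assumes init: "I 0 (set_nmem s i 0)" "nmem s j = N" "nmem s 4 = 1" "i \<noteq> j" "i \<noteq> 4"
    and body: "\<And>k s. \<lbrakk>k < N; I k s; nmem s i = k; nmem s j = N; nmem s 4 = 1\<rbrakk> \<Longrightarrow>
       wp G c n (\<lambda>s'. nmem s' i = k \<and> nmem s' j = N \<and> nmem s' 4 = 1 \<and>
         I (Suc k) (set_nmem s' i (Suc k))) s"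
    and exit: "\<And>s. \<lbrakk>I N s; nmem s i = N\<rbrakk> \<Longrightarrow> Q s"
  shows "wp G (for_loop i j c) (N * (n + 3) + 3) Q s"
proof -
  define J where "J v s \<longleftrightarrow> v \<le> N \<and> I (N - v) s \<and> nmem s i = N - v \<and> nmem s j = N \<and> nmem s 4 = 1"
    for v s
  have "wp G (While (NLess i j) (Seq c (Do (NAdd i i 4)))) (N * Suc (n + 2) + 1) Q (set_nmem s i 0)"
  proof (rule wp_While[where I = J])
    show "J N (set_nmem s i 0)"
      using init by (auto simp: J_def)
  next
    fix v s assume J: "J v s" and h: "holds (NLess i j) s"
    then obtain u where u: "v = Suc u" by (cases v) (auto simp: J_def)
    with J have uN: "N - u = Suc (N - v)" "N - v < N" by (auto simp: J_def)
    have "wp G (Seq c (Do (NAdd i i 4))) (Suc (n + 1)) (J u) s"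
    proof (rule wp_Seq, rule wp_mono[OF body])
      fix s' assume s': "nmem s' i = N - v \<and> nmem s' j = N \<and> nmem s' 4 = 1 \<and>
         I (Suc (N - v)) (set_nmem s' i (Suc (N - v)))"
      show "wp G (Do (NAdd i i 4)) 1 (J u) s'"
        by (rule wp_Do[OF exec_instr.simps(3)]) (use s' u uN J init in \<open>auto simp: J_def\<close>)
    qed (use J uN in \<open>auto simp: J_def\<close>)
    with u show "\<exists>u. v = Suc u \<and> wp G (Seq c (Do (NAdd i i 4))) (n + 2) (J u) s"
      by simp
  next
    fix v s assume "J v s" "\<not> holds (NLess i j) s"
    then have "v = 0" by (auto simp: J_def init)
    with \<open>J v s\<close> show "Q s" using exit by (auto simp: J_def)
  qed
  then have "wp G (for_loop i j c) (Suc (1 + (N * Suc (n + 2) + 1))) Q s"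
    unfolding for_loop_def by (intro wp_Seq wp_Do[OF exec_instr.simps(1)])
  then show ?thesis by (rule wp_mono) (auto simp: algebra_simps)
qed

section \<open>The programs\<close>

text \<open>The programs keep the four sizes in cells 0 to 3, the constant 1 in cell 4, the address 32
  of a table of digits in cell 5, the number \<open>m\<close> of samples in cell 6 and the address \<open>32 + m\<close> in
  cell 7.  Digit \<open>i < m\<close> is the \<open>i\<close>-th sampled question, digit \<open>m + i\<close> the answer guessed
  for it.\<close>

definition initialized :: "free_game \<Rightarrow> nat \<Rightarrow> state \<Rightarrow> bool" where
  "initialized G m s \<longleftrightarrow> nmem s 0 = nX G \<and> nmem s 1 = nY G \<and> nmem s 2 = nA G \<and> nmem s 3 = nB G \<and>
     nmem s 4 = 1 \<and> nmem s 5 = 32 \<and> nmem s 6 = m \<and> nmem s 7 = 32 + m"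

definition digits :: "state \<Rightarrow> nat \<Rightarrow> nat" where
  "digits s i = nmem s (32 + i)"

text \<open>Registers are allotted by nesting depth: an inner program writes only to low cells above
  the parameters, an outer loop keeps its data higher up. So the frame of an inner program weakens
  to that of the enclosing one. Real cell 0 is protected because it holds the best value found so
  far.\<close>

definition frame :: "nat \<Rightarrow> nat \<Rightarrow> state \<Rightarrow> state \<Rightarrow> bool" where
  "frame u v s s' \<longleftrightarrow> (\<forall>j. j < 8 \<or> u \<le> j \<longrightarrow> nmem s' j = nmem s j) \<and>
     (\<forall>j. j = 0 \<or> v \<le> j \<longrightarrow> rmem s' j = rmem s j)"

lemma frame_trans:
  "frame u v s s' \<Longrightarrow> frame u' v' s' s'' \<Longrightarrow> u' \<le> u \<Longrightarrow> v' \<le> v \<Longrightarrow> frame u v s s''"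
  by (simp add: frame_def)

lemma frame_initialized: "frame u v s s' \<Longrightarrow> initialized G m s' \<longleftrightarrow> initialized G m s"
  by (simp add: frame_def initialized_def)

lemma frame_digits: "frame u v s s' \<Longrightarrow> u \<le> 32 \<Longrightarrow> digits s' = digits s"
  by (auto simp: frame_def digits_def)

section \<open>Evaluating one guess\<close>

text \<open>Not divided by \<open>m\<close>: it is only compared across different \<open>b\<close>,
  and scaling does not move the maximum.\<close>

definition sample_sum :: "free_game \<Rightarrow> nat \<Rightarrow> (nat \<Rightarrow> nat) \<Rightarrow> nat \<Rightarrow> nat \<Rightarrow> real" where
  "sample_sum G m D y b = (\<Sum>i<m. table_entry G (D i) y (D (m + i)) b)"

fun argmax_below :: "(nat \<Rightarrow> real) \<Rightarrow> nat \<Rightarrow> nat" where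
  "argmax_below f 0 = 0"
| "argmax_below f (Suc n) = (if f (argmax_below f n) < f n then n else argmax_below f n)"

lemma argmax_below_less: "0 < n \<Longrightarrow> argmax_below f n < n"
  by (induction n) (auto simp: less_Suc_eq)

lemma argmax_below_ge: "i < n \<Longrightarrow> f i \<le> f (argmax_below f n)"
  by (induction n) (auto simp: less_Suc_eq intro: less_imp_le order.trans)

definition best_response :: "free_game \<Rightarrow> nat \<Rightarrow> (nat \<Rightarrow> nat) \<Rightarrow> nat \<Rightarrow> nat" where
  "best_response G m D y = argmax_below (sample_sum G m D y) (nB G)"

text \<open>For a free game this is |X||Y| times the value of the strategy \<open>b\<close> against
  a best first player, who may optimise each \<open>x\<close> separately. The inserted 0 mirrors the
  start of the running maximum and changes nothing for nonnegative payoffs.\<close>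

definition response_value :: "free_game \<Rightarrow> (nat \<Rightarrow> nat) \<Rightarrow> real" where
  "response_value G b = (\<Sum>x<nX G. Max (insert 0
     ((\<lambda>a. \<Sum>y<nY G. table_entry G x y a (b y)) ` {..<nA G})))"

text \<open>The nested loops keep the current \<open>b\<close>, \<open>y\<close>, \<open>a\<close>,
  \<open>x\<close> in cells 13 to 16, and cell 12 receives the response to \<open>y\<close>. A real
  cell is cleared by subtracting it from itself, as no instruction loads a real constant.\<close>

definition sum_com :: com where
  "sum_com = Seq (block [RSub 1 1 1])
     (for_loop 11 6 (block [NAdd 8 5 11, NLoad 9 8, NAdd 8 7 11, NLoad 10 8,
        Query 2 9 14 10 13, RAdd 1 1 2]))"

definition response_com :: com where
  "response_com = Seq (block [NConst 12 0, RSub 3 3 3])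
     (for_loop 13 3 (Seq sum_com (IfThenElse (RLess 3 1) (block [NMove 12 13, RMove 3 1]) (block []))))"

text \<open>The response to \<open>y\<close> is recomputed for every \<open>x\<close> and
  \<open>a\<close> instead of being tabulated. The time bounds tolerate this, since |X| still enters
  the cost of one guess only once.\<close>

definition answer_com :: com where
  "answer_com = Seq (block [RSub 4 4 4])
     (for_loop 14 1 (Seq response_com (block [Query 2 16 14 15 12, RAdd 4 4 2])))"

definition question_com :: com where
  "question_com = Seq (block [RSub 5 5 5])
     (for_loop 15 2 (Seq answer_com (IfThenElse (RLess 5 4) (block [RMove 5 4]) (block []))))"

definition evaluate_com :: com where
  "evaluate_com = Seq (Seq (block [RSub 6 6 6])
     (for_loop 16 0 (Seq question_com (block [RAdd 6 6 5]))))
     (IfThenElse (RLess 0 6) (block [RMove 0 6]) (block []))"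

lemma table_entry_nonneg: "is_free_game G \<Longrightarrow> 0 \<le> table_entry G x y a b"
  by (auto simp: table_entry_def is_free_game_def)

lemma table_entry_le_1: "is_free_game G \<Longrightarrow> table_entry G x y a b \<le> 1"
  by (auto simp: table_entry_def is_free_game_def)

lemma sample_sum_nonneg: "is_free_game G \<Longrightarrow> 0 \<le> sample_sum G m D y b"
  by (auto simp: sample_sum_def intro!: sum_nonneg table_entry_nonneg)

lemma wp_sum_com:
  assumes "initialized G m s"
  shows "wp G sum_com (16 * m + 7) (\<lambda>s'. frame 12 3 s s' \<and>
    rmem s' 1 = sample_sum G m (digits s) (nmem s 14) (nmem s 13)) s"
proof -
  define F where "F i = table_entry G (digits s i) (nmem s 14) (digits s (m + i)) (nmem s 13)" for i
  define I where "I k s' \<longleftrightarrow> frame 12 3 s s' \<and> rmem s' 1 = (\<Sum>i<k. F i)" for k s'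
  have "wp G sum_com (Suc (2 * length [RSub 1 1 1] + 1 + (m * (2 * length [NAdd 8 5 11, NLoad 9 8,
        NAdd 8 7 11, NLoad 10 8, Query 2 9 14 10 13, RAdd 1 1 2] + 1 + 3) + 3)))
    (\<lambda>s'. frame 12 3 s s' \<and> rmem s' 1 = sample_sum G m (digits s) (nmem s 14) (nmem s 13)) s"
    unfolding sum_com_def
  proof (intro wp_Seq wp_block wp_for_loop[where I = I])
    fix k s'
    assume k: "k < m" "nmem s' 11 = k" "nmem s' 6 = m" "nmem s' 4 = 1" and I: "I k s'"
    have fr: "frame 12 3 s s'" using I by (simp add: I_def)
    have ini: "nmem s' 5 = 32" "nmem s' 7 = 32 + m"
      using fr assms frame_initialized unfolding initialized_def by blast+
    have dg: "nmem s' (32 + k) = digits s k" "nmem s' (32 + m + k) = digits s (m + k)"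
      using frame_digits[OF fr] by (auto simp: digits_def add.assoc fun_eq_iff)
    have r: "nmem s' 14 = nmem s 14" "nmem s' 13 = nmem s 13" using fr by (auto simp: frame_def)
    have r1: "rmem s' 1 = (\<Sum>i<k. F i)" using I by (simp add: I_def)
    let ?s = "fold (det_exec G) [NAdd 8 5 11, NLoad 9 8, NAdd 8 7 11, NLoad 10 8,
        Query 2 9 14 10 13, RAdd 1 1 2] s'"
    have s: "?s = s'\<lparr>nmem := (nmem s')(9 := digits s k, 8 := 32 + m + k, 10 := digits s (m + k)),
       rmem := (rmem s')(2 := F k, 1 := (\<Sum>i<Suc k. F i))\<rparr>"
      using k(2-4) ini dg r r1 by (simp add: F_def fun_upd_twist)
    show "nmem ?s 11 = k \<and> nmem ?s 6 = m \<and> nmem ?s 4 = 1 \<and> I (Suc k) (set_nmem ?s 11 (Suc k))"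
      unfolding s using k(2-4) fr by (simp add: I_def frame_def)
  qed (use assms in \<open>auto simp: I_def F_def sample_sum_def initialized_def frame_def\<close>)
  then show ?thesis by (rule wp_mono) auto
qed

lemma wp_response_com:
  assumes "initialized G m s" "is_free_game G"
  shows "wp G response_com (nB G * (16 * m + 17) + 9) (\<lambda>s'. frame 14 4 s s' \<and>
    nmem s' 12 = best_response G m (digits s) (nmem s 14)) s"
proof -
  define F where "F = sample_sum G m (digits s) (nmem s 14)"
  define I where "I k s' \<longleftrightarrow> frame 14 4 s s' \<and> nmem s' 12 = argmax_below F k \<and>
    rmem s' 3 = (if k = 0 then 0 else F (argmax_below F k))" for k s'
  have "wp G response_com (Suc (2 * length [NConst 12 0, RSub 3 3 3] + 1 +
      (nB G * (Suc ((16 * m + 7) + 6) + 3) + 3)))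
    (\<lambda>s'. frame 14 4 s s' \<and> nmem s' 12 = best_response G m (digits s) (nmem s 14)) s"
    unfolding response_com_def
  proof (intro wp_Seq wp_block wp_for_loop[where I = I])
    fix k s'
    assume k: "k < nB G" "nmem s' 13 = k" "nmem s' 3 = nB G" "nmem s' 4 = 1" and I: "I k s'"
    have fr: "frame 14 4 s s'" using I by (simp add: I_def)
    have ini: "initialized G m s'" using fr assms frame_initialized by blast
    have dg: "digits s' = digits s" by (rule frame_digits[OF fr]) simp
    have r: "nmem s' 14 = nmem s 14" using fr by (auto simp: frame_def)
    show "wp G sum_com (16 * m + 7)
          (wp G (IfThenElse (RLess 3 1) (block [NMove 12 13, RMove 3 1]) (block [])) 6
            (\<lambda>s'. nmem s' 13 = k \<and> nmem s' 3 = nB G \<and> nmem s' 4 = 1 \<and>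
                   I (Suc k) (set_nmem s' 13 (Suc k)))) s'"
    proof (rule wp_mono[OF wp_sum_com[OF ini]])
      fix s'' assume s'': "frame 12 3 s' s'' \<and>
          rmem s'' 1 = sample_sum G m (digits s') (nmem s' 14) (nmem s' 13)"
      then have fr'': "frame 14 4 s s''" using fr frame_trans by fastforce
      have r'': "nmem s'' 12 = argmax_below F k" "nmem s'' 13 = k" "nmem s'' 3 = nB G" "nmem s'' 4 = 1"
          "rmem s'' 3 = (if k = 0 then 0 else F (argmax_below F k))"
        using s'' k(2-4) I by (auto simp: frame_def I_def)
      have v: "rmem s'' 1 = F k" using s'' by (simp add: dg r k F_def)
      \<comment> \<open>The running maximum starts at 0 rather than at \<open>F 0\<close>.
        Nonnegativity makes the two agree after the first round: if the test fails there,
        \<open>F 0\<close> is 0.\<close>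
      have nn: "0 \<le> F k" unfolding F_def by (rule sample_sum_nonneg) fact
      have "wp G (IfThenElse (RLess 3 1) (block [NMove 12 13, RMove 3 1]) (block []))
          (2 * (length [NMove 12 13, RMove 3 1] + length ([] :: instr list)) + 2)
            (\<lambda>s'. nmem s' 13 = k \<and> nmem s' 3 = nB G \<and> nmem s' 4 = 1 \<and>
                   I (Suc k) (set_nmem s' 13 (Suc k))) s''"
        by (rule wp_If_block)
          (use v r'' nn fr'' in \<open>auto simp: I_def frame_def split: if_splits\<close>)
      then show "wp G (IfThenElse (RLess 3 1) (block [NMove 12 13, RMove 3 1]) (block [])) 6
            (\<lambda>s'. nmem s' 13 = k \<and> nmem s' 3 = nB G \<and> nmem s' 4 = 1 \<and>
                   I (Suc k) (set_nmem s' 13 (Suc k))) s''" by simp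
    qed simp
  qed (use assms in \<open>auto simp: I_def F_def best_response_def initialized_def frame_def\<close>)
  then show ?thesis by (rule wp_mono) auto
qed

lemma wp_answer_com:
  assumes "initialized G m s" "is_free_game G"
  shows "wp G answer_com (nY G * (nB G * (16 * m + 17) + 18) + 7) (\<lambda>s'. frame 15 5 s s' \<and>
    rmem s' 4 = (\<Sum>y<nY G. table_entry G (nmem s 16) y (nmem s 15)
      (best_response G m (digits s) y))) s"
proof -
  define F where "F y = table_entry G (nmem s 16) y (nmem s 15) (best_response G m (digits s) y)" for y
  define I where "I k s' \<longleftrightarrow> frame 15 5 s s' \<and> rmem s' 4 = (\<Sum>y<k. F y)" for k s'
  have "wp G answer_com (Suc (2 * length [RSub 4 4 4] + 1 +
      (nY G * (Suc ((nB G * (16 * m + 17) + 9) + (2 * length [Query 2 16 14 15 12, RAdd 4 4 2] + 1)) + 3) + 3)))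
    (\<lambda>s'. frame 15 5 s s' \<and> rmem s' 4 = (\<Sum>y<nY G. F y)) s"
    unfolding answer_com_def
  proof (intro wp_Seq wp_block wp_for_loop[where I = I])
    fix k s'
    assume k: "k < nY G" "nmem s' 14 = k" "nmem s' 1 = nY G" "nmem s' 4 = 1" and I: "I k s'"
    have fr: "frame 15 5 s s'" using I by (simp add: I_def)
    have ini: "initialized G m s'" using fr assms frame_initialized by blast
    have dg: "digits s' = digits s" by (rule frame_digits[OF fr]) simp
    show "wp G response_com (nB G * (16 * m + 17) + 9)
          (wp G (block [Query 2 16 14 15 12, RAdd 4 4 2]) (2 * length [Query 2 16 14 15 12, RAdd 4 4 2] + 1)
            (\<lambda>s'. nmem s' 14 = k \<and> nmem s' 1 = nY G \<and> nmem s' 4 = 1 \<and>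
                   I (Suc k) (set_nmem s' 14 (Suc k)))) s'"
    proof (rule wp_mono[OF wp_response_com[OF ini assms(2)]], rule le_refl, rule wp_block)
      fix s'' assume s'': "frame 14 4 s' s'' \<and> nmem s'' 12 = best_response G m (digits s') (nmem s' 14)"
      then have fr'': "frame 15 5 s s''" using fr by (auto simp: frame_def)
      have r'': "nmem s'' 14 = k" "nmem s'' 1 = nY G" "nmem s'' 4 = 1" "rmem s'' 4 = (\<Sum>y<k. F y)"
        "nmem s'' 15 = nmem s 15" "nmem s'' 16 = nmem s 16"
        using s'' k(2-4) I by (auto simp: frame_def I_def)
      have b: "nmem s'' 12 = best_response G m (digits s) k" using s'' by (simp add: dg k)
      show "nmem (fold (det_exec G) [Query 2 16 14 15 12, RAdd 4 4 2] s'') 14 = k \<and>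
         nmem (fold (det_exec G) [Query 2 16 14 15 12, RAdd 4 4 2] s'') 1 = nY G \<and>
         nmem (fold (det_exec G) [Query 2 16 14 15 12, RAdd 4 4 2] s'') 4 = 1 \<and>
         I (Suc k) (set_nmem (fold (det_exec G) [Query 2 16 14 15 12, RAdd 4 4 2] s'') 14 (Suc k))"
        using r'' b fr'' by (auto simp: I_def frame_def F_def)
    qed auto
  qed (use assms in \<open>auto simp: I_def F_def initialized_def frame_def\<close>)
  then show ?thesis unfolding F_def by (rule wp_mono) auto
qed

lemma wp_question_com:
  assumes "initialized G m s" "is_free_game G"
  shows "wp G question_com (nA G * (nY G * (nB G * (16 * m + 17) + 18) + 15) + 7)
    (\<lambda>s'. frame 16 6 s s' \<and> rmem s' 5 = Max (insert 0 ((\<lambda>a. \<Sum>y<nY G.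
      table_entry G (nmem s 16) y a (best_response G m (digits s) y)) ` {..<nA G}))) s"
proof -
  define F where "F a = (\<Sum>y<nY G. table_entry G (nmem s 16) y a (best_response G m (digits s) y))" for a
  define M where "M k = Max (insert 0 (F ` {..<k}))" for k
  define I where "I k s' \<longleftrightarrow> frame 16 6 s s' \<and> rmem s' 5 = M k" for k s'
  have M_Suc: "M (Suc k) = max (M k) (F k)" for k
    by (simp add: M_def lessThan_Suc insert_commute[of 0] max.commute)
  have M_0: "M 0 = 0"
    by (simp add: M_def)
  have "wp G question_com (Suc (2 * length [RSub 5 5 5] + 1 +
      (nA G * (Suc ((nY G * (nB G * (16 * m + 17) + 18) + 7) + (2 * (length [RMove 5 4] + length ([] :: instr list)) + 2)) + 3) + 3)))
    (\<lambda>s'. frame 16 6 s s' \<and> rmem s' 5 = M (nA G)) s"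
    unfolding question_com_def
  proof (intro wp_Seq wp_block wp_for_loop[where I = I])
    fix k s'
    assume k: "k < nA G" "nmem s' 15 = k" "nmem s' 2 = nA G" "nmem s' 4 = 1" and I: "I k s'"
    have fr: "frame 16 6 s s'" using I by (simp add: I_def)
    have ini: "initialized G m s'" using fr assms frame_initialized by blast
    have dg: "digits s' = digits s" by (rule frame_digits[OF fr]) simp
    have r: "nmem s' 16 = nmem s 16" using fr by (auto simp: frame_def)
    show "wp G answer_com (nY G * (nB G * (16 * m + 17) + 18) + 7)
          (wp G (IfThenElse (RLess 5 4) (block [RMove 5 4]) (block []))
            (2 * (length [RMove 5 4] + length ([] :: instr list)) + 2)
            (\<lambda>s'. nmem s' 15 = k \<and> nmem s' 2 = nA G \<and> nmem s' 4 = 1 \<and>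
                   I (Suc k) (set_nmem s' 15 (Suc k)))) s'"
    proof (rule wp_mono[OF wp_answer_com[OF ini assms(2)]], rule le_refl, rule wp_If_block)
      fix s'' assume s'': "frame 15 5 s' s'' \<and> rmem s'' 4 = (\<Sum>y<nY G. table_entry G (nmem s' 16) y
        (nmem s' 15) (best_response G m (digits s') y))"
      then have fr'': "frame 16 6 s s''" using fr by (auto simp: frame_def)
      have r'': "nmem s'' 15 = k" "nmem s'' 2 = nA G" "nmem s'' 4 = 1"
         "rmem s'' 5 = M k"
        using s'' k(2-4) I by (auto simp: frame_def I_def)
      have v: "rmem s'' 4 = F k" using s'' by (simp add: dg k r F_def)
      let ?s = "fold (det_exec G) [RMove 5 4] s''" and ?t = "fold (det_exec G) [] s''"
      show "nmem ?s 15 = k \<and> nmem ?s 2 = nA G \<and> nmem ?s 4 = 1 \<and> I (Suc k) (set_nmem ?s 15 (Suc k))"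
        if "holds (RLess 5 4) s''"
        using r'' v fr'' that unfolding I_def M_Suc by (auto simp: frame_def)
      show "nmem ?t 15 = k \<and> nmem ?t 2 = nA G \<and> nmem ?t 4 = 1 \<and> I (Suc k) (set_nmem ?t 15 (Suc k))"
        if "\<not> holds (RLess 5 4) s''"
        using r'' v fr'' that unfolding I_def M_Suc by (auto simp: frame_def)
    qed auto
  qed (use assms in \<open>auto simp: I_def M_0 initialized_def frame_def\<close>)
  then show ?thesis unfolding F_def M_def by (rule wp_mono) auto
qed

text \<open>Real cell 0 is the one protected cell that may change here, so the frame condition is
  stated with its old content put back.\<close>

lemma wp_evaluate_com:
  assumes "initialized G m s" "is_free_game G"
  shows "wp G evaluate_com
    (nX G * (nA G * (nY G * (nB G * (16 * m + 17) + 18) + 15) + 14) + 12)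
    (\<lambda>s'. frame 17 7 s (set_rmem s' 0 (rmem s 0)) \<and>
      rmem s' 0 = max (rmem s 0) (response_value G (best_response G m (digits s)))) s"
proof -
  define F where "F x = Max (insert 0 ((\<lambda>a. \<Sum>y<nY G.
      table_entry G x y a (best_response G m (digits s) y)) ` {..<nA G}))" for x
  define I where "I k s' \<longleftrightarrow> frame 17 7 s s' \<and> rmem s' 6 = (\<Sum>x<k. F x)" for k s'
  have F: "response_value G (best_response G m (digits s)) = (\<Sum>x<nX G. F x)"
    by (simp add: response_value_def F_def)
  have "wp G evaluate_com (Suc (Suc (2 * length [RSub 6 6 6] + 1 +
      (nX G * (Suc ((nA G * (nY G * (nB G * (16 * m + 17) + 18) + 15) + 7) + (2 * length [RAdd 6 6 5] + 1)) + 3) + 3))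
      + (2 * (length [RMove 0 6] + length ([] :: instr list)) + 2)))
    (\<lambda>s'. frame 17 7 s (set_rmem s' 0 (rmem s 0)) \<and>
      rmem s' 0 = max (rmem s 0) (\<Sum>x<nX G. F x)) s"
    unfolding evaluate_com_def
  proof (intro wp_Seq wp_block wp_for_loop[where I = I])
    fix k s'
    assume k: "k < nX G" "nmem s' 16 = k" "nmem s' 0 = nX G" "nmem s' 4 = 1" and I: "I k s'"
    have fr: "frame 17 7 s s'" using I by (simp add: I_def)
    have ini: "initialized G m s'" using fr assms frame_initialized by blast
    have dg: "digits s' = digits s" by (rule frame_digits[OF fr]) simp
    show "wp G question_com (nA G * (nY G * (nB G * (16 * m + 17) + 18) + 15) + 7)
          (wp G (block [RAdd 6 6 5]) (2 * length [RAdd 6 6 5] + 1)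
            (\<lambda>s'. nmem s' 16 = k \<and> nmem s' 0 = nX G \<and> nmem s' 4 = 1 \<and>
                   I (Suc k) (set_nmem s' 16 (Suc k)))) s'"
    proof (rule wp_mono[OF wp_question_com[OF ini assms(2)]], rule le_refl, rule wp_block)
      fix s'' assume s'': "frame 16 6 s' s'' \<and> rmem s'' 5 = Max (insert 0 ((\<lambda>a. \<Sum>y<nY G.
        table_entry G (nmem s' 16) y a (best_response G m (digits s') y)) ` {..<nA G}))"
      then have fr'': "frame 17 7 s s''" using fr by (auto simp: frame_def)
      have r'': "nmem s'' 16 = k" "nmem s'' 0 = nX G" "nmem s'' 4 = 1" "rmem s'' 6 = (\<Sum>x<k. F x)"
        using s'' k(2-4) I by (auto simp: frame_def I_def)
      have v: "rmem s'' 5 = F k" using s'' by (simp add: dg k F_def)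
      let ?s = "fold (det_exec G) [RAdd 6 6 5] s''"
      show "nmem ?s 16 = k \<and> nmem ?s 0 = nX G \<and> nmem ?s 4 = 1 \<and> I (Suc k) (set_nmem ?s 16 (Suc k))"
        using r'' v fr'' by (auto simp: frame_def I_def)
    qed auto
  next
    fix s' assume I: "I (nX G) s'"
    then have fr: "rmem s' 0 = rmem s 0" "frame 17 7 s s'" "rmem s' 6 = (\<Sum>x<nX G. F x)"
      by (auto simp: frame_def I_def)
    show "wp G (IfThenElse (RLess 0 6) (block [RMove 0 6]) (block []))
          (2 * (length [RMove 0 6] + length ([] :: instr list)) + 2)
          (\<lambda>s'. frame 17 7 s (set_rmem s' 0 (rmem s 0)) \<and>
            rmem s' 0 = max (rmem s 0) (\<Sum>x<nX G. F x)) s'"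
      by (rule wp_If_block) (use fr in \<open>auto simp: frame_def\<close>)
  qed (use assms in \<open>auto simp: I_def initialized_def frame_def\<close>)
  then show ?thesis unfolding F by (rule wp_mono) auto
qed

section \<open>Enumeration by a mixed-radix counter\<close>

text \<open>The value of a mixed-radix numeral, least significant digit first, where digit
  \<open>j\<close> has base \<open>w j\<close>.\<close>

definition radix_rank :: "(nat \<Rightarrow> nat) \<Rightarrow> (nat \<Rightarrow> nat) \<Rightarrow> nat \<Rightarrow> nat" where
  "radix_rank w d n = (\<Sum>j<n. d j * prod w {..<j})"

lemma radix_rank_simps [simp]:
  "radix_rank w d 0 = 0"
  "radix_rank w d (Suc n) = radix_rank w d n + d n * prod w {..<n}"
  by (simp_all add: radix_rank_def)

lemma radix_rank_less: "(\<And>j. j < n \<Longrightarrow> d j < w j) \<Longrightarrow> radix_rank w d n < prod w {..<n}"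
proof (induction n)
  case (Suc n)
  then have "radix_rank w d n < prod w {..<n}" by simp
  then have "radix_rank w d (Suc n) < Suc (d n) * prod w {..<n}" by simp
  also have "\<dots> \<le> w n * prod w {..<n}"
    using Suc.prems[of n] by (intro mult_right_mono) auto
  finally show ?case by (simp add: mult.commute)
qed simp

text \<open>Uniqueness of mixed-radix numerals: division by the product of the lower bases isolates
  the top digit, and the remainder is the rank of the others.\<close>

lemma radix_rank_inj:
  assumes "\<And>j. j < n \<Longrightarrow> d j < w j" "\<And>j. j < n \<Longrightarrow> e j < w j"
    and "radix_rank w d n = radix_rank w e n" "j < n"
  shows "d j = e j"
  using assms
proof (induction n)
  case (Suc n)
  let ?W = "prod w {..<n}"
  have less: "radix_rank w d n < ?W" "radix_rank w e n < ?W"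
    using Suc.prems by (auto intro: radix_rank_less)
  have "(radix_rank w d n + d n * ?W) div ?W = (radix_rank w e n + e n * ?W) div ?W"
    "(radix_rank w d n + d n * ?W) mod ?W = (radix_rank w e n + e n * ?W) mod ?W"
    using Suc.prems(3) by simp_all
  moreover have "?W \<noteq> 0"
    using less(1) by linarith
  ultimately have "d n = e n" "radix_rank w d n = radix_rank w e n"
    using less by auto
  with Suc show ?case by (auto simp: less_Suc_eq)
qed simp

lemma radix_rank_cong:
  "(\<And>j. j < n \<Longrightarrow> d j = e j) \<Longrightarrow> radix_rank w d n = radix_rank w e n"
  by (simp add: radix_rank_def)

definition digit_bound :: "free_game \<Rightarrow> nat \<Rightarrow> nat \<Rightarrow> nat" where
  "digit_bound G m i = (if i < m then nX G else nA G)"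

text \<open>Cells 21 and 22 hold the address of the first digit to be enumerated and the number of
  digits to be enumerated; the final carry in cell 23 tells that the enumeration is complete.\<close>

definition increment_com :: com where
  "increment_com = Seq (block [NConst 23 1]) (for_loop 11 22
     (Seq (block [NAdd 8 21 11, NLoad 9 8, NAdd 9 9 23])
     (Seq (IfThenElse (NLess 8 7) (block [NMove 10 0]) (block [NMove 10 2]))
     (Seq (IfThenElse (NLess 9 10) (block [NConst 23 0]) (block [NConst 9 0]))
       (Do (NStore 8 9))))))"

text \<open>Addition of 1 by ripple carry, the initial carry being the unit to add. Counting the
  carry as one more digit, whose weight is the product of all bases treated so far, makes the
  equation on ranks an invariant of the loop.\<close>

lemma wp_increment_com:
  assumes "initialized G m s" "nmem s 21 = 32 + q" "nmem s 22 = n"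
    and valid: "\<And>i. i < n \<Longrightarrow> digits s (q + i) < digit_bound G m (q + i)"
  defines "w \<equiv> \<lambda>i. digit_bound G m (q + i)"
  shows "wp G increment_com (n * 26 + 7) (\<lambda>s'.
    (\<forall>j. j < 8 \<or> 12 \<le> j \<and> j \<noteq> 23 \<and> (j < 32 + q \<or> 32 + q + n \<le> j) \<longrightarrow> nmem s' j = nmem s j) \<and>
    rmem s' = rmem s \<and> (\<forall>i<n. digits s' (q + i) < w i) \<and> nmem s' 23 \<le> 1 \<and>
    radix_rank w (\<lambda>i. digits s' (q + i)) n + nmem s' 23 * prod w {..<n} =
      Suc (radix_rank w (\<lambda>i. digits s (q + i)) n)) s"
proof -
  define I where "I k s' \<longleftrightarrow> 
    (\<forall>j. j < 8 \<or> 12 \<le> j \<and> j \<noteq> 23 \<and> (j < 32 + q \<or> 32 + q + k \<le> j) \<longrightarrow> nmem s' j = nmem s j) \<and>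
    rmem s' = rmem s \<and> (\<forall>i<k. digits s' (q + i) < w i) \<and> nmem s' 23 \<le> 1 \<and>
    radix_rank w (\<lambda>i. digits s' (q + i)) k + nmem s' 23 * prod w {..<k} =
      Suc (radix_rank w (\<lambda>i. digits s (q + i)) k)" for k s'
  have "wp G increment_com (Suc (2 * length [NConst 23 1] + 1 +
     (n * (Suc ((2 * length [NAdd 8 21 11, NLoad 9 8, NAdd 9 9 23] + 1) +
       Suc ((2 * (length [NMove 10 0] + length [NMove 10 2]) + 2) +
       Suc ((2 * (length [NConst 23 0] + length [NConst 9 0]) + 2) + 1))) + 3) + 3))) (I n) s"
    unfolding increment_com_def
  proof (intro wp_Seq wp_block wp_for_loop[where I = I])
    fix k s'
    assume k: "k < n" "nmem s' 11 = k" "nmem s' 22 = n" "nmem s' 4 = 1" and I: "I k s'"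
    define d c where "d = digits s (q + k)" and "c = nmem s' 23"
    define s1 where "s1 = fold (det_exec G) [NAdd 8 21 11, NLoad 9 8, NAdd 9 9 23] s'"
    have r: "nmem s' 7 = 32 + m" "nmem s' 0 = nX G" "nmem s' 2 = nA G" "nmem s' 21 = 32 + q"
      using I assms by (auto simp: I_def initialized_def)
    have d: "nmem s' (32 + q + k) = d"
      using I by (auto simp: I_def d_def digits_def add.assoc)
    have s1: "s1 = s'\<lparr>nmem := (nmem s')(8 := 32 + q + k, 9 := d + c)\<rparr>"
      using r k d by (simp add: s1_def c_def)
    define s2 where "s2 = s'\<lparr>nmem := (nmem s')(8 := 32 + q + k, 9 := d + c, 10 := w k)\<rparr>"
    define s3 where "s3 = s'\<lparr>nmem := (nmem s')(8 := 32 + q + k, 10 := w k,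
      9 := (if d + c < w k then d + c else 0), 23 := (if d + c < w k then 0 else c))\<rparr>"
    define s4 where "s4 = set_nmem s3 (32 + q + k) (if d + c < w k then d + c else 0)"
    let ?post = "\<lambda>s'. nmem s' 11 = k \<and> nmem s' 22 = n \<and> nmem s' 4 = 1 \<and>
       I (Suc k) (set_nmem s' 11 (Suc k))"
    have "I (Suc k) (set_nmem s4 11 (Suc k))"
    proof -
      let ?s = "set_nmem s4 11 (Suc k)"
      have c1: "c \<le> 1" and dw: "d < w k"
        using I valid k by (auto simp: I_def c_def d_def w_def)
      have dig: "digits ?s (q + i) = digits s' (q + i)" if "i < k" for i
        using that by (simp add: digits_def s4_def s3_def)
      have digk: "digits ?s (q + k) = (if d + c < w k then d + c else 0)"
        by (simp add: digits_def s4_def s3_def add.assoc)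
      have car: "nmem ?s 23 = (if d + c < w k then 0 else c)"
        by (simp add: s4_def s3_def)
      have "radix_rank w (\<lambda>i. digits ?s (q + i)) k = radix_rank w (\<lambda>i. digits s' (q + i)) k"
        by (rule radix_rank_cong) (rule dig)
      moreover have "radix_rank w (\<lambda>i. digits s' (q + i)) k + c * prod w {..<k} =
          Suc (radix_rank w (\<lambda>i. digits s (q + i)) k)"
        using I by (simp add: I_def c_def)
      \<comment> \<open>Overflow happens only at the largest digit with carry 1. Writing 0 and
        keeping the carry then preserves the total, because \<open>d + 1\<close> equals the
        base.\<close>
      moreover have "w k = Suc d \<and> c = 1" if "\<not> d + c < w k"
        using that c1 dw by auto
      ultimately have "radix_rank w (\<lambda>i. digits ?s (q + i)) (Suc k) +
          nmem ?s 23 * prod w {..<Suc k} = Suc (radix_rank w (\<lambda>i. digits s (q + i)) (Suc k))"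
        unfolding radix_rank_simps digk car d_def[symmetric]
        by (cases "d + c < w k") (auto simp: algebra_simps)
      moreover have "\<forall>i<Suc k. digits ?s (q + i) < w i"
        using I dig digk dw by (auto simp: less_Suc_eq I_def)
      moreover have "nmem ?s j = nmem s j"
        if "j < 8 \<or> 12 \<le> j \<and> j \<noteq> 23 \<and> (j < 32 + q \<or> 32 + q + Suc k \<le> j)" for j
        using I that by (auto simp: I_def s4_def s3_def)
      moreover have "rmem ?s = rmem s"
        using I by (auto simp: I_def s4_def s3_def)
      ultimately show ?thesis
        using car c1 unfolding I_def by simp
    qed
    then have s4: "?post s4"
      using k by (simp add: s4_def s3_def)
    have s3: "wp G (Do (NStore 8 9)) 1 ?post s3"
      by (rule wp_Do[OF exec_instr.simps(6)]) (use s4 in \<open>simp add: s4_def s3_def\<close>)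
    have s2: "wp G (IfThenElse (NLess 9 10) (block [NConst 23 0]) (block [NConst 9 0]))
      (2 * (length [NConst 23 0] + length [NConst 9 0]) + 2) (wp G (Do (NStore 8 9)) 1 ?post) s2"
    proof (rule wp_If_block)
      assume "holds (NLess 9 10) s2"
      then have "fold (det_exec G) [NConst 23 0] s2 = s3"
        by (auto simp: s2_def s3_def fun_eq_iff)
      then show "wp G (Do (NStore 8 9)) 1 ?post (fold (det_exec G) [NConst 23 0] s2)"
        using s3 by simp
    next
      assume "\<not> holds (NLess 9 10) s2"
      then have "fold (det_exec G) [NConst 9 0] s2 = s3"
        by (auto simp: s2_def s3_def c_def fun_eq_iff)
      then show "wp G (Do (NStore 8 9)) 1 ?post (fold (det_exec G) [NConst 9 0] s2)"
        using s3 by simp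
    qed simp
    show "wp G (IfThenElse (NLess 8 7) (block [NMove 10 0]) (block [NMove 10 2]))
      (2 * (length [NMove 10 0] + length [NMove 10 2]) + 2)
      (wp G (Seq (IfThenElse (NLess 9 10) (block [NConst 23 0]) (block [NConst 9 0])) (Do (NStore 8 9)))
        (Suc ((2 * (length [NConst 23 0] + length [NConst 9 0]) + 2) + 1)) ?post)
      (fold (det_exec G) [NAdd 8 21 11, NLoad 9 8, NAdd 9 9 23] s')"
      unfolding s1_def[symmetric]
    proof (rule wp_If_block)
      \<comment> \<open>Cell 7 holds the first address after the questions, so comparing addresses
        decides whether the base is |X| or |A|.\<close>
      assume "holds (NLess 8 7) s1"
      then have "fold (det_exec G) [NMove 10 0] s1 = s2"
        using r by (auto simp: s1 s2_def w_def digit_bound_def)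
      then show "wp G (Seq (IfThenElse (NLess 9 10) (block [NConst 23 0]) (block [NConst 9 0])) (Do (NStore 8 9)))
        (Suc ((2 * (length [NConst 23 0] + length [NConst 9 0]) + 2) + 1)) ?post
        (fold (det_exec G) [NMove 10 0] s1)"
        using wp_Seq[OF s2] by simp
    next
      assume "\<not> holds (NLess 8 7) s1"
      then have "fold (det_exec G) [NMove 10 2] s1 = s2"
        using r by (auto simp: s1 s2_def w_def digit_bound_def)
      then show "wp G (Seq (IfThenElse (NLess 9 10) (block [NConst 23 0]) (block [NConst 9 0])) (Do (NStore 8 9)))
        (Suc ((2 * (length [NConst 23 0] + length [NConst 9 0]) + 2) + 1)) ?post
        (fold (det_exec G) [NMove 10 2] s1)"
        using wp_Seq[OF s2] by simp
    qed simp
  qed (use assms in \<open>auto simp: I_def initialized_def\<close>)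
  then show ?thesis unfolding I_def by (rule wp_mono) auto
qed

section \<open>Exhaustive search over the guesses\<close>

lemma best_response_cong:
  "(\<And>i. i < 2 * m \<Longrightarrow> D i = E i) \<Longrightarrow> best_response G m D = best_response G m E"
  unfolding best_response_def sample_sum_def
  by (intro ext arg_cong2[where f = argmax_below] sum.cong refl) simp

text \<open>Cell 4 holds 1, so the test asks whether the carry is still 0.\<close>

definition search_com :: com where
  "search_com = While (NLess 23 4) (Seq evaluate_com increment_com)"

text \<open>The cost of one round. The 21 is 12 from the evaluation, 7 from the increment and 2 for
  the test and the \<open>Seq\<close>.\<close>

definition search_time :: "free_game \<Rightarrow> nat \<Rightarrow> nat \<Rightarrow> nat" where
  "search_time G m n =
    nX G * (nA G * (nY G * (nB G * (16 * m + 17) + 18) + 15) + 14) + n * 26 + 21"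

text \<open>The first \<open>q\<close> digits stay fixed: \<open>q = 0\<close> serves the
  deterministic program, which enumerates questions too, and \<open>q = m\<close> the randomized
  one. Ranks are visited consecutively from 0, and a rank determines its guess, so none is
  missed.\<close>

lemma wp_search_com:
  assumes G: "is_free_game G" and s: "initialized G m s" "nmem s 21 = 32 + q" "nmem s 22 = n"
      "nmem s 23 = 0" "rmem s 0 = 0"
    and qn: "q + n = 2 * m" and zero: "\<And>i. i < n \<Longrightarrow> digits s (q + i) = 0"
    and U: "0 \<le> U" "\<And>D. response_value G (best_response G m D) \<le> U"
  defines "w \<equiv> \<lambda>i. digit_bound G m (q + i)"
  shows "wp G search_com (prod w {..<n} * search_time G m n + 1) (\<lambda>s'.
    initialized G m s' \<and> rmem s' 0 \<le> U \<and>
    (\<forall>E. (\<forall>i<q. E i = digits s i) \<longrightarrow> (\<forall>i<n. E (q + i) < w i) \<longrightarrow>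
       response_value G (best_response G m E) \<le> rmem s' 0)) s"
proof -
  let ?val = "\<lambda>E. response_value G (best_response G m E)"
  let ?W = "prod w {..<n}"
  define rank where "rank E = radix_rank w (\<lambda>i. E (q + i)) n" for E :: "nat \<Rightarrow> nat"
  define valid where "valid E \<longleftrightarrow> (\<forall>i<q. E i = digits s i) \<and> (\<forall>i<n. E (q + i) < w i)" for E
  have rank_less: "rank E < ?W" if "valid E" for E
    unfolding rank_def by (rule radix_rank_less) (use that in \<open>auto simp: valid_def\<close>)
  \<comment> \<open>Best responses read only the first \<open>2 * m\<close> digits, and these are
    fixed by the rank. Hence visiting the rank of \<open>E\<close> amounts to evaluating
    \<open>E\<close> itself.\<close>
  have val_eq: "?val D = ?val E" if "valid D" "valid E" "rank D = rank E" for D E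
  proof -
    have *: "D (q + i) = E (q + i)" if "i < n" for i
      using radix_rank_inj[of n "\<lambda>i. D (q + i)" w "\<lambda>i. E (q + i)" i] \<open>valid D\<close> \<open>valid E\<close> \<open>rank D = rank E\<close> that
      by (auto simp: valid_def rank_def)
    have "D i = E i" if "i < 2 * m" for i
    proof (cases "i < q")
      case False
      then show ?thesis using *[of "i - q"] that qn by simp
    qed (use \<open>valid D\<close> \<open>valid E\<close> in \<open>auto simp: valid_def\<close>)
    then show ?thesis by (metis best_response_cong)
  qed
  \<comment> \<open>All guesses of smaller rank are already in the maximum. Once the carry is 1 the
    counter has wrapped round to rank 0, so completeness is then claimed for every rank. The variant
    counts the ranks left.\<close>
  define J where "J v s' \<longleftrightarrow> initialized G m s' \<and> nmem s' 21 = 32 + q \<and> nmem s' 22 = n \<and>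
    nmem s' 23 \<le> 1 \<and> valid (digits s') \<and> rmem s' 0 \<le> U \<and>
    (\<forall>E. valid E \<longrightarrow> nmem s' 23 = 1 \<or> rank E < rank (digits s') \<longrightarrow> ?val E \<le> rmem s' 0) \<and>
    v = (if nmem s' 23 = 0 then ?W - rank (digits s') else 0)" for v s'
  have w_pos: "0 < w i" for i
    using G by (auto simp: w_def digit_bound_def is_free_game_def)
  have "rank (digits s) = 0"
    unfolding rank_def radix_rank_def by (intro sum.neutral) (use zero in auto)
  then have J0: "J ?W s"
    using s U w_pos zero by (auto simp: J_def valid_def)
  have "wp G search_com (?W * Suc (Suc ((nX G * (nA G * (nY G * (nB G * (16 * m + 17) + 18) + 15) + 14) + 12)
      + (n * 26 + 7))) + 1) (\<lambda>s'. initialized G m s' \<and> rmem s' 0 \<le> U \<and> (\<forall>E. valid E \<longrightarrow> ?val E \<le> rmem s' 0)) s"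
    unfolding search_com_def
  proof (rule wp_While[where I = J, OF J0])
    fix v s' assume J: "J v s'" and "holds (NLess 23 4) s'"
    then have carry: "nmem s' 23 = 0" by (auto simp: J_def initialized_def)
    let ?D = "digits s'"
    have D: "valid ?D" using J by (simp add: J_def)
    have v: "v = Suc (?W - Suc (rank ?D))"
      using J carry rank_less[OF D] by (simp add: J_def)
    have "wp G evaluate_com (nX G * (nA G * (nY G * (nB G * (16 * m + 17) + 18) + 15) + 14) + 12)
      (wp G increment_com (n * 26 + 7) (J (?W - Suc (rank ?D)))) s'"
    proof (rule wp_mono[OF wp_evaluate_com])
      fix s1 assume s1: "frame 17 7 s' (set_rmem s1 0 (rmem s' 0)) \<and> rmem s1 0 = max (rmem s' 0) (?val ?D)"
      have ini: "initialized G m s1" "nmem s1 21 = 32 + q" "nmem s1 22 = n" "nmem s1 23 = 0"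
        using s1 J carry by (auto simp: frame_def J_def initialized_def)
      have dig: "digits s1 = ?D"
        using s1 by (auto simp: frame_def digits_def fun_eq_iff)
      show "wp G increment_com (n * 26 + 7) (J (?W - Suc (rank ?D))) s1"
      proof (rule wp_mono[OF wp_increment_com[OF ini(1-3)]])
        show "digits s1 (q + i) < digit_bound G m (q + i)" if "i < n" for i
          using D that by (simp add: dig valid_def w_def)
      next
        fix s2 assume s2: "(\<forall>j. j < 8 \<or> 12 \<le> j \<and> j \<noteq> 23 \<and> (j < 32 + q \<or> 32 + q + n \<le> j) \<longrightarrow>
              nmem s2 j = nmem s1 j) \<and> rmem s2 = rmem s1 \<and>
            (\<forall>i<n. digits s2 (q + i) < digit_bound G m (q + i)) \<and> nmem s2 23 \<le> 1 \<and>
            radix_rank (\<lambda>i. digit_bound G m (q + i)) (\<lambda>i. digits s2 (q + i)) n +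
              nmem s2 23 * prod (\<lambda>i. digit_bound G m (q + i)) {..<n} =
            Suc (radix_rank (\<lambda>i. digit_bound G m (q + i)) (\<lambda>i. digits s1 (q + i)) n)"
        then have cells: "nmem s2 j = nmem s1 j"
          if "j < 8 \<or> 12 \<le> j \<and> j \<noteq> 23 \<and> (j < 32 + q \<or> 32 + q + n \<le> j)" for j
          using that by blast
        have rk: "rank (digits s2) + nmem s2 23 * ?W = Suc (rank ?D)"
          using s2 by (simp add: rank_def w_def dig)
        have ini2: "initialized G m s2" "nmem s2 21 = 32 + q" "nmem s2 22 = n"
          using ini cells by (simp_all add: initialized_def)
        have "digits s2 i = digits s1 i" if "i < q" for i
          unfolding digits_def by (rule cells) (use that in auto)
        then have D2: "valid (digits s2)"
          using s2 D by (auto simp: valid_def dig w_def)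
        have r: "rmem s2 0 = max (rmem s' 0) (?val ?D)"
          using s1 s2 by simp
        have "?val E \<le> rmem s2 0" if E: "valid E" "nmem s2 23 = 1 \<or> rank E < rank (digits s2)" for E
        proof -
          \<comment> \<open>With carry 1, \<open>Suc (rank ?D)\<close> is at least \<open>?W\<close>
            and so above every rank; with carry 0 it is the new rank.\<close>
          have "rank E < Suc (rank ?D)"
            using E(2) rk rank_less[OF E(1)] by auto
          then consider "rank E < rank ?D" | "rank E = rank ?D" by linarith
          then show ?thesis
          proof cases
            case 1
            then have "?val E \<le> rmem s' 0" using J E(1) by (simp add: J_def)
            then show ?thesis by (simp add: r)
          next
            case 2
            then show ?thesis using val_eq[OF E(1) D] by (simp add: r)
          qed
        qed
        moreover have "rmem s2 0 \<le> U"
          using J U by (simp add: r J_def)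
        moreover have "nmem s2 23 \<le> 1" using s2 by simp
        moreover have "?W - Suc (rank ?D) = (if nmem s2 23 = 0 then ?W - rank (digits s2) else 0)"
        proof (cases "nmem s2 23 = 0")
          case False
          with \<open>nmem s2 23 \<le> 1\<close> have "nmem s2 23 = 1" by simp
          with rk show ?thesis by simp
        qed (use rk in simp)
        ultimately show "J (?W - Suc (rank ?D)) s2"
          unfolding J_def using ini2 D2 by blast
      qed simp
    qed (use J G in \<open>auto simp: J_def\<close>)
    then show "\<exists>u. v = Suc u \<and> wp G (Seq evaluate_com increment_com)
      (Suc ((nX G * (nA G * (nY G * (nB G * (16 * m + 17) + 18) + 15) + 14) + 12) + (n * 26 + 7))) (J u) s'"
      unfolding v by (blast intro: wp_Seq)
  next
    fix v s' assume "J v s'" "\<not> holds (NLess 23 4) s'"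
    then show "initialized G m s' \<and> rmem s' 0 \<le> U \<and> (\<forall>E. valid E \<longrightarrow> ?val E \<le> rmem s' 0)"
      by (auto simp: J_def initialized_def)
  qed
  then show ?thesis
    by (rule wp_mono) (auto simp: search_time_def valid_def)
qed

section \<open>Computing the number of samples\<close>

text \<open>Doubling 1 until it reaches the content of cell \<open>j\<close> takes the rounded-up
  binary logarithm many rounds. Each adds \<open>K\<close> from cell 17 to cell 6, which replaces
  both a logarithm and a multiplication.\<close>

definition double_com :: "nat \<Rightarrow> com" where
  "double_com j = Seq (block [NConst 8 1]) (While (NLess 8 j) (block [NAdd 8 8 8, NAdd 6 6 17]))"

lemma wp_double_com:
  assumes "0 < nmem s j" "j < 6"
  shows "wp G (double_com j) (nmem s j * 6 + 5) (\<lambda>s'. \<exists>l. nmem s j \<le> 2 ^ l \<and> 2 ^ l \<le> 2 * nmem s j \<and>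
    s' = s\<lparr>nmem := (nmem s)(8 := 2 ^ l, 6 := nmem s 6 + nmem s 17 * l)\<rparr>) s"
proof -
  define N where "N = nmem s j"
  define st where "st l = s\<lparr>nmem := (nmem s)(8 := 2 ^ l, 6 := nmem s 6 + nmem s 17 * l)\<rparr>" for l
  define I where "I v s' \<longleftrightarrow> (\<exists>l. 2 ^ l \<le> 2 * N \<and> s' = st l \<and> v = N - l)" for v s'
  have st_j: "nmem (st l) j = N" for l using assms by (simp add: st_def N_def)
  have "wp G (double_com j) (Suc (2 * length [NConst 8 1] + 1 +
    (N * Suc (2 * length [NAdd 8 8 8, NAdd 6 6 17] + 1) + 1)))
    (\<lambda>s'. \<exists>l. N \<le> 2 ^ l \<and> 2 ^ l \<le> 2 * N \<and> s' = st l) s"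
    unfolding double_com_def
  proof (intro wp_Seq wp_block, simp)
    have s0: "fold (det_exec G) [NConst 8 1] s = st 0"
      by (auto simp: st_def fun_eq_iff)
    show "wp G (While (NLess 8 j) (block [NAdd 8 8 8, NAdd 6 6 17]))
      (N * Suc (2 * length [NAdd 8 8 8, NAdd 6 6 17] + 1) + 1)
      (\<lambda>s'. \<exists>l. N \<le> 2 ^ l \<and> 2 ^ l \<le> 2 * N \<and> s' = st l) (fold (det_exec G) [NConst 8 1] s)"
      unfolding s0
    proof (rule wp_While[where I = I])
      show "I N (st 0)" using assms by (auto simp: I_def N_def intro!: exI[of _ 0])
    next
      fix v s' assume "I v s'" and h: "holds (NLess 8 j) s'"
      then obtain l where l: "2 ^ l \<le> 2 * N" "s' = st l" "v = N - l" by (auto simp: I_def)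
      \<comment> \<open>The failed bound keeps the next power at most \<open>2 * N\<close>. Together
        with \<open>l < 2 ^ l\<close> it makes \<open>N\<close> a sufficient, if crude, limit on the
        rounds.\<close>
      have lN: "2 ^ l < N" using h st_j[of l] unfolding l by (simp add: st_def)
      moreover have "l < 2 ^ l" by (rule less_exp)
      ultimately have v: "v = Suc (N - Suc l)" using l by linarith
      have "fold (det_exec G) [NAdd 8 8 8, NAdd 6 6 17] s' = st (Suc l)"
        unfolding l by (simp add: st_def fun_upd_twist mult_2 add_ac)
      then have "I (N - Suc l) (fold (det_exec G) [NAdd 8 8 8, NAdd 6 6 17] s')"
        using lN by (auto simp: I_def intro!: exI[of _ "Suc l"])
      then show "\<exists>u. v = Suc u \<and> wp G (block [NAdd 8 8 8, NAdd 6 6 17])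
          (2 * length [NAdd 8 8 8, NAdd 6 6 17] + 1) (I u) s'"
        using v by (intro exI[of _ "N - Suc l"] conjI wp_block) auto
    next
      fix v s' assume "I v s'" "\<not> holds (NLess 8 j) s'"
      then obtain l where l: "2 ^ l \<le> 2 * N" "s' = st l" "\<not> holds (NLess 8 j) (st l)"
        by (auto simp: I_def)
      then have "N \<le> 2 ^ l" using st_j[of l] by (simp add: st_def)
      with l show "\<exists>l. N \<le> 2 ^ l \<and> 2 ^ l \<le> 2 * N \<and> s' = st l" by blast
    qed
  qed
  then show ?thesis unfolding N_def st_def by (rule wp_mono) auto
qed

text \<open>Treating |Y| and |B| separately avoids forming their product; the two roundings cost a
  factor 4. The count starts at \<open>K\<close>, not 0, which gives \<open>K * Suc l\<close> and a
  positive \<open>m\<close> even if both sizes are 1.\<close>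

definition setup_com :: "nat \<Rightarrow> com" where
  "setup_com K = Seq (block [NConst 4 1, NConst 17 K, NMove 6 17])
     (Seq (double_com 1) (Seq (double_com 3) (block [NConst 5 32, NAdd 7 5 6])))"

text \<open>A fixed final state \<open>s\<close> is extracted so that sampling can be studied as a
  distribution started there. The zeros matter later: cell 11 counts samples, cell 23 is the carry,
  and the digits to be enumerated must start at 0.\<close>

lemma wp_setup_com:
  assumes "is_free_game G"
  obtains l s where "nY G * nB G \<le> 2 ^ l" "2 ^ l \<le> 4 * (nY G * nB G)"
    "initialized G (K * Suc l) s" "rmem s = (\<lambda>_. 0)"
    "\<And>j. j = 11 \<or> 18 \<le> j \<Longrightarrow> nmem s j = 0"
    "wp G (setup_com K) (nY G * 6 + nB G * 6 + 25) ((=) s) (initial_state G)"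
proof -
  let ?Q = "\<lambda>s. \<exists>l. nY G * nB G \<le> 2 ^ l \<and> 2 ^ l \<le> 4 * (nY G * nB G) \<and>
    initialized G (K * Suc l) s \<and> rmem s = (\<lambda>_. 0) \<and> (\<forall>j. j = 11 \<or> 18 \<le> j \<longrightarrow> nmem s j = 0)"
  define s0 where "s0 = fold (det_exec G) [NConst 4 1, NConst 17 K, NMove 6 17] (initial_state G)"
  have s0: "nmem s0 0 = nX G" "nmem s0 1 = nY G" "nmem s0 2 = nA G" "nmem s0 3 = nB G"
    "nmem s0 4 = 1" "nmem s0 17 = K" "nmem s0 6 = K" "rmem s0 = (\<lambda>_. 0)"
    "\<And>j. j = 11 \<or> 18 \<le> j \<Longrightarrow> nmem s0 j = 0"
    by (auto simp: s0_def initial_state_def)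
  have "wp G (setup_com K) (Suc (2 * length [NConst 4 1, NConst 17 K, NMove 6 17] + 1 +
    Suc ((nY G * 6 + 5) + Suc ((nB G * 6 + 5) + (2 * length [NConst 5 32, NAdd 7 5 6] + 1))))) ?Q
    (initial_state G)"
    unfolding setup_com_def
  proof (intro wp_Seq wp_block, simp, fold s0_def)
    show "wp G (double_com 1) (nY G * 6 + 5)
      (wp G (Seq (double_com 3) (block [NConst 5 32, NAdd 7 5 6]))
        (Suc ((nB G * 6 + 5) + (2 * length [NConst 5 32, NAdd 7 5 6] + 1))) ?Q) s0"
    proof (rule wp_mono[OF wp_double_com])
      fix s1 assume "\<exists>l. nmem s0 1 \<le> 2 ^ l \<and> 2 ^ l \<le> 2 * nmem s0 1 \<and>
        s1 = s0\<lparr>nmem := (nmem s0)(8 := 2 ^ l, 6 := nmem s0 6 + nmem s0 17 * l)\<rparr>"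
      then obtain l1 where l1: "nY G \<le> 2 ^ l1" "2 ^ l1 \<le> 2 * nY G"
        and s1: "s1 = s0\<lparr>nmem := (nmem s0)(8 := 2 ^ l1, 6 := K + K * l1)\<rparr>"
        using s0 by auto
      show "wp G (Seq (double_com 3) (block [NConst 5 32, NAdd 7 5 6]))
        (Suc ((nB G * 6 + 5) + (2 * length [NConst 5 32, NAdd 7 5 6] + 1))) ?Q s1"
      proof (rule wp_Seq, rule wp_mono[OF wp_double_com])
        fix s2 assume "\<exists>l. nmem s1 3 \<le> 2 ^ l \<and> 2 ^ l \<le> 2 * nmem s1 3 \<and>
          s2 = s1\<lparr>nmem := (nmem s1)(8 := 2 ^ l, 6 := nmem s1 6 + nmem s1 17 * l)\<rparr>"
        then obtain l2 where l2: "nB G \<le> 2 ^ l2" "2 ^ l2 \<le> 2 * nB G"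
          and s2: "s2 = s1\<lparr>nmem := (nmem s1)(8 := 2 ^ l2, 6 := K + K * l1 + K * l2)\<rparr>"
          using s0 by (auto simp: s1)
        have "nY G * nB G \<le> 2 ^ (l1 + l2)" "2 ^ (l1 + l2) \<le> 4 * (nY G * nB G)"
          using mult_le_mono[OF l1(1) l2(1)] mult_le_mono[OF l1(2) l2(2)] by (simp_all add: power_add)
        then show "wp G (block [NConst 5 32, NAdd 7 5 6]) (2 * length [NConst 5 32, NAdd 7 5 6] + 1) ?Q s2"
          by (intro wp_block exI[of _ "l1 + l2"])
             (use s0 in \<open>auto simp: s1 s2 initialized_def algebra_simps\<close>)
      qed (use s0 assms in \<open>auto simp: s1 is_free_game_def\<close>)
    qed (use s0 assms in \<open>auto simp: is_free_game_def\<close>)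
  qed
  then obtain k s where "\<forall>cs. steps G k (setup_com K # cs, initial_state G) = return_pmf (cs, s)"
    "k \<le> nY G * 6 + nB G * 6 + 25" "?Q s"
    by (rule wpE) auto
  then show thesis using that by (blast intro: wpI)
qed

section \<open>Drawing the questions\<close>

definition sample_com :: com where
  "sample_com = While (NLess 11 6)
     (Seq (Do (Rand 9 0)) (block [NAdd 8 5 11, NStore 8 9, NAdd 11 11 4]))"

definition put_sample :: "free_game \<Rightarrow> nat \<Rightarrow> state \<Rightarrow> state" where
  "put_sample G x s = fold (det_exec G) [NAdd 8 5 11, NStore 8 9, NAdd 11 11 4] (set_nmem s 9 x)"

lemma put_sample:
  assumes "initialized G m s"
  shows "put_sample G x s = s\<lparr>nmem := (nmem s)(9 := x, 8 := 32 + nmem s 11,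
    32 + nmem s 11 := x, 11 := Suc (nmem s 11))\<rparr>"
  using assms by (simp add: put_sample_def initialized_def)

lemma initialized_put_sample: "initialized G m s \<Longrightarrow> initialized G m (put_sample G x s)"
  by (simp add: put_sample) (simp add: initialized_def)

text \<open>Every round takes exactly ten steps whatever is drawn: test, \<open>Seq\<close>,
  \<open>Rand\<close> and seven for the block. So all outcomes finish simultaneously, and the final
  distribution is an image of independent draws.\<close>

lemma steps_sample_com:
  assumes "initialized G m s" "nmem s 11 + r = m" "0 < nX G"
  shows "steps G (10 * r + 1) (sample_com # cs, s) =
    map_pmf (\<lambda>xs. (cs, fold (put_sample G) xs s)) (replicate_pmf r (pmf_of_set {..<nX G}))"
  using assms(1,2)
proof (induction r arbitrary: s)
  case 0
  then show ?case
    by (simp add: sample_com_def initialized_def bind_return_pmf)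
next
  case (Suc r)
  let ?is = "[NAdd 8 5 11, NStore 8 9, NAdd 11 11 4]" and ?p = "pmf_of_set {..<nX G}"
  have "nmem s 11 < nmem s 6" "max (Suc 0) (nmem s 0) = nX G"
    using Suc.prems assms(3) by (auto simp: initialized_def)
  moreover have "steps G 0 = return_pmf" by (simp add: fun_eq_iff)
  ultimately have "steps G (Suc (Suc (Suc 0))) (sample_com # cs, s) =
      map_pmf (\<lambda>x. (block ?is # sample_com # cs, set_nmem s 9 x)) ?p"
    by (simp add: sample_com_def bind_return_pmf map_pmf_comp bind_return_pmf')
  then have "steps G 3 (sample_com # cs, s) =
      map_pmf (\<lambda>x. (block ?is # sample_com # cs, set_nmem s 9 x)) ?p"
    by (simp only: numeral_3_eq_3)
  moreover have "steps G 7 (block ?is # sample_com # cs, set_nmem s 9 x) =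
      return_pmf (sample_com # cs, put_sample G x s)" for x
    using steps_block[of ?is G "sample_com # cs" "set_nmem s 9 x"] by (simp add: put_sample_def)
  ultimately have "steps G (3 + 7) (sample_com # cs, s) =
      map_pmf (\<lambda>x. (sample_com # cs, put_sample G x s)) ?p"
    unfolding steps_add by (simp add: bind_map_pmf) (simp add: map_pmf_def)
  then have "steps G (10 + (10 * r + 1)) (sample_com # cs, s) =
      bind_pmf ?p (\<lambda>x. steps G (10 * r + 1) (sample_com # cs, put_sample G x s))"
    unfolding steps_add[of G 10] by (simp add: bind_map_pmf)
  also have "\<dots> = bind_pmf ?p (\<lambda>x. map_pmf (\<lambda>xs. (cs, fold (put_sample G) xs (put_sample G x s)))
      (replicate_pmf r ?p))"
  proof (intro bind_pmf_cong refl Suc.IH)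
    fix x show "initialized G m (put_sample G x s)"
      by (rule initialized_put_sample) fact
    show "nmem (put_sample G x s) 11 + r = m"
      using Suc.prems by (simp add: put_sample)
  qed
  finally show ?case
    by (simp add: map_bind_pmf map_pmf_def bind_assoc_pmf bind_return_pmf)
qed

lemma fold_put_sample:
  assumes "initialized G m s"
  shows "initialized G m (fold (put_sample G) xs s)" (is ?A)
    "rmem (fold (put_sample G) xs s) = rmem s" (is ?B)
    "\<And>j. 12 \<le> j \<Longrightarrow> j < 32 + nmem s 11 \<or> 32 + nmem s 11 + length xs \<le> j \<Longrightarrow>
       nmem (fold (put_sample G) xs s) j = nmem s j" (is "PROP ?C")
    "\<And>i. i < length xs \<Longrightarrow> nmem (fold (put_sample G) xs s) (32 + nmem s 11 + i) = xs ! i"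
    (is "PROP ?D")
proof -
  have "?A \<and> ?B \<and> (\<forall>j\<ge>12. j < 32 + nmem s 11 \<or> 32 + nmem s 11 + length xs \<le> j \<longrightarrow>
       nmem (fold (put_sample G) xs s) j = nmem s j) \<and>
     (\<forall>i<length xs. nmem (fold (put_sample G) xs s) (32 + nmem s 11 + i) = xs ! i)"
    using assms
  proof (induction xs arbitrary: s)
    case (Cons x xs)
    let ?s = "put_sample G x s" and ?t = "fold (put_sample G) (x # xs) s"
    note IH = Cons.IH[OF initialized_put_sample[OF Cons.prems, of x]]
    have s11: "nmem ?s 11 = Suc (nmem s 11)" using Cons.prems by (simp add: put_sample)
    have "nmem ?t j = nmem s j"
      if "12 \<le> j" "j < 32 + nmem s 11 \<or> 32 + nmem s 11 + length (x # xs) \<le> j" for j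
    proof -
      have "nmem ?t j = nmem ?s j" using IH that by (auto simp: s11)
      also have "\<dots> = nmem s j" using Cons.prems that by (auto simp: put_sample)
      finally show ?thesis .
    qed
    moreover have "nmem ?t (32 + nmem s 11 + i) = (x # xs) ! i" if "i < length (x # xs)" for i
    proof (cases i)
      case 0
      have "nmem ?t (32 + nmem s 11) = nmem ?s (32 + nmem s 11)" using IH by (simp add: s11)
      also have "\<dots> = x" using Cons.prems by (simp add: put_sample)
      finally show ?thesis using 0 by simp
    next
      case (Suc i')
      then show ?thesis using IH that by (auto simp: s11 add.assoc)
    qed
    moreover have "rmem ?t = rmem s" using IH Cons.prems by (simp add: put_sample)
    ultimately show ?case using IH by simp
  qed simp
  then show ?A ?B "PROP ?C" "PROP ?D" by blast+
qed

section \<open>Responses to a representative sample\<close>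

lemma pair_pmf_of_set_prod:
  assumes "finite A" "A \<noteq> {}" "finite B" "B \<noteq> {}"
  shows "pair_pmf (pmf_of_set A) (pmf_of_set B) = pmf_of_set (A \<times> B)"
proof (rule pmf_eqI)
  fix z
  show "pmf (pair_pmf (pmf_of_set A) (pmf_of_set B)) z = pmf (pmf_of_set (A \<times> B)) z"
    by (cases z) (simp add: pmf_pair assms card_cartesian_product indicator_times)
qed

text \<open>Clearing the denominator yields the unnormalised sums that the programs compute.\<close>

lemma win_expectation_eq:
  assumes "is_free_game G" "\<And>x. x < nX G \<Longrightarrow> a x < nA G" "\<And>y. y < nY G \<Longrightarrow> b y < nB G"
  shows "real (nX G * nY G) * win_expectation G a b =
    (\<Sum>x<nX G. \<Sum>y<nY G. table_entry G x y (a x) (b y))"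
proof -
  have pos: "0 < nX G" "0 < nY G" using assms(1) by (auto simp: is_free_game_def)
  have "win_expectation G a b =
    (\<Sum>(x, y)\<in>{..<nX G} \<times> {..<nY G}. payoff G x y (a x) (b y)) / real (nX G * nY G)"
    unfolding win_expectation_def using pos
    by (subst pair_pmf_of_set_prod) (auto simp: integral_pmf_of_set card_cartesian_product lessThan_empty_iff)
  also have "(\<Sum>(x, y)\<in>{..<nX G} \<times> {..<nY G}. payoff G x y (a x) (b y)) =
     (\<Sum>x<nX G. \<Sum>y<nY G. table_entry G x y (a x) (b y))"
    unfolding sum.cartesian_product[symmetric]
    by (intro sum.cong refl) (use assms in \<open>auto simp: table_entry_def\<close>)
  finally show ?thesis using pos by simp
qed

lemma win_expectation_cong:
  assumes "is_free_game G" "\<And>x. x < nX G \<Longrightarrow> a x = a' x" "\<And>y. y < nY G \<Longrightarrow> b y = b' y"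
  shows "win_expectation G a b = win_expectation G a' b'"
  unfolding win_expectation_def
  by (intro integral_cong_AE) (use assms in \<open>auto simp: AE_measure_pmf_iff is_free_game_def lessThan_empty_iff\<close>)

lemma finite_win_expectations:
  "finite {win_expectation G a b | a b. a \<in> {..<nX G} \<rightarrow>\<^sub>E {..<nA G} \<and> b \<in> {..<nY G} \<rightarrow>\<^sub>E {..<nB G}}"
proof -
  have "{win_expectation G a b | a b. a \<in> {..<nX G} \<rightarrow>\<^sub>E {..<nA G} \<and> b \<in> {..<nY G} \<rightarrow>\<^sub>E {..<nB G}} =
    (\<lambda>(a, b). win_expectation G a b) ` (({..<nX G} \<rightarrow>\<^sub>E {..<nA G}) \<times> ({..<nY G} \<rightarrow>\<^sub>E {..<nB G}))"
    by auto
  also have "finite \<dots>" by (intro finite_imageI finite_cartesian_product finite_PiE) auto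
  finally show ?thesis .
qed

lemma win_expectation_le_game_value:
  assumes "is_free_game G" "\<And>x. x < nX G \<Longrightarrow> a x < nA G" "\<And>y. y < nY G \<Longrightarrow> b y < nB G"
  shows "win_expectation G a b \<le> game_value G"
proof -
  let ?a = "restrict a {..<nX G}" and ?b = "restrict b {..<nY G}"
  have "win_expectation G a b = win_expectation G ?a ?b"
    by (rule win_expectation_cong) (use assms in auto)
  also have "\<dots> \<le> game_value G"
    unfolding game_value_def
  proof (intro Max_ge finite_win_expectations CollectI exI conjI refl)
    show "?a \<in> {..<nX G} \<rightarrow>\<^sub>E {..<nA G}" "?b \<in> {..<nY G} \<rightarrow>\<^sub>E {..<nB G}"
      using assms by auto
  qed simp
  finally show ?thesis .
qed

lemma game_value_attained:
  assumes "is_free_game G"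
  obtains a b where "\<forall>x. a x < nA G" "\<forall>y. b y < nB G" "game_value G = win_expectation G a b"
proof -
  let ?S = "{win_expectation G a b | a b. a \<in> {..<nX G} \<rightarrow>\<^sub>E {..<nA G} \<and> b \<in> {..<nY G} \<rightarrow>\<^sub>E {..<nB G}}"
  have pos: "0 < nA G" "0 < nB G" using assms by (auto simp: is_free_game_def)
  then have "restrict (\<lambda>_. 0) {..<nX G} \<in> {..<nX G} \<rightarrow>\<^sub>E {..<nA G}"
    "restrict (\<lambda>_. 0) {..<nY G} \<in> {..<nY G} \<rightarrow>\<^sub>E {..<nB G}" by auto
  then have "?S \<noteq> {}" by blast
  then have "game_value G \<in> ?S"
    unfolding game_value_def by (intro Max_in finite_win_expectations)
  then obtain a b where ab: "game_value G = win_expectation G a b"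
    "a \<in> {..<nX G} \<rightarrow>\<^sub>E {..<nA G}" "b \<in> {..<nY G} \<rightarrow>\<^sub>E {..<nB G}" by blast
  \<comment> \<open>Maximisers from the extensional function space are \<open>undefined\<close> off
    the question sets; the default 0 makes their bounds hold everywhere.\<close>
  define a' b' where "a' x = (if x < nX G then a x else 0)" and "b' y = (if y < nY G then b y else 0)" for x y
  have "win_expectation G a b = win_expectation G a' b'"
    by (rule win_expectation_cong) (use assms in \<open>auto simp: a'_def b'_def\<close>)
  with ab(1) have eq: "game_value G = win_expectation G a' b'" by simp
  show thesis
    by (rule that[OF _ _ eq]) (use ab pos in \<open>auto simp: a'_def b'_def\<close>)
qed

lemma game_value_bounds:
  assumes "is_free_game G"
  shows "0 \<le> game_value G" "game_value G \<le> 1"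
proof -
  obtain a b where ab: "\<forall>x. a x < nA G" "\<forall>y. b y < nB G" "game_value G = win_expectation G a b"
    using assms by (rule game_value_attained)
  let ?S = "\<Sum>x<nX G. \<Sum>y<nY G. table_entry G x y (a x) (b y)"
  have eq: "real (nX G * nY G) * game_value G = ?S"
    unfolding ab(3) by (rule win_expectation_eq) (use assms ab in auto)
  have "?S \<le> (\<Sum>x<nX G. \<Sum>y<nY G. 1)"
    by (intro sum_mono table_entry_le_1 assms)
  then have "?S \<le> real (nX G * nY G)" by simp
  moreover have "0 \<le> ?S" by (intro sum_nonneg table_entry_nonneg assms)
  moreover have "0 < real (nX G * nY G)" using assms by (simp add: is_free_game_def)
  ultimately show "0 \<le> game_value G" "game_value G \<le> 1"
    unfolding eq[symmetric] using mult_le_cancel_left_pos[of "real (nX G * nY G)" "game_value G" 1]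
    by (auto simp: zero_le_mult_iff)
qed

text \<open>Choosing a maximising answer for each \<open>x\<close> gives an actual strategy of the
  first player, so the left side comes from a legitimate pair of strategies.\<close>

lemma response_value_le:
  assumes G: "is_free_game G" and b: "\<And>y. y < nY G \<Longrightarrow> b y < nB G"
  shows "response_value G b \<le> real (nX G * nY G) * game_value G"
proof -
  define F where "F x a = (\<Sum>y<nY G. table_entry G x y a (b y))" for x a
  have "\<exists>a<nA G. Max (insert 0 (F x ` {..<nA G})) \<le> F x a" for x
  proof -
    \<comment> \<open>Should the maximum be the inserted 0, the answer 0 still does at least as
      well.\<close>
    have "0 \<le> F x 0" unfolding F_def by (intro sum_nonneg table_entry_nonneg G)
    moreover have "0 < nA G" using G by (simp add: is_free_game_def)
    moreover have "Max (insert 0 (F x ` {..<nA G})) \<in> insert 0 (F x ` {..<nA G})"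
      by (rule Max_in) auto
    ultimately show ?thesis by (metis imageE insertE lessThan_iff order_refl)
  qed
  then obtain a where a: "\<And>x. a x < nA G" "\<And>x. Max (insert 0 (F x ` {..<nA G})) \<le> F x (a x)" by metis
  have "response_value G b = (\<Sum>x<nX G. Max (insert 0 (F x ` {..<nA G})))"
    by (simp add: response_value_def F_def)
  also have "\<dots> \<le> (\<Sum>x<nX G. F x (a x))" by (intro sum_mono a)
  also have "\<dots> = real (nX G * nY G) * win_expectation G a b"
    unfolding F_def by (rule win_expectation_eq[symmetric]) (use G a b in auto)
  also have "\<dots> \<le> real (nX G * nY G) * game_value G"
    by (intro mult_left_mono win_expectation_le_game_value) (use G a b in auto)
  finally show ?thesis .
qed

lemma response_value_ge:
  assumes "\<And>x. a x < nA G"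
  shows "(\<Sum>x<nX G. \<Sum>y<nY G. table_entry G x y (a x) (b y)) \<le> response_value G b"
  unfolding response_value_def by (intro sum_mono Max_ge) (use assms in auto)

lemma best_response_less: "is_free_game G \<Longrightarrow> best_response G m D y < nB G"
  by (simp add: best_response_def argmax_below_less is_free_game_def)

definition question_pmf :: "free_game \<Rightarrow> nat pmf" where
  "question_pmf G = pmf_of_set {..<nX G}"

definition deviation :: "free_game \<Rightarrow> (nat \<Rightarrow> nat) \<Rightarrow> nat list \<Rightarrow> nat \<Rightarrow> nat \<Rightarrow> real" where
  "deviation G a xs y b = sum_list (map (\<lambda>x. table_entry G x y (a x) b -
     measure_pmf.expectation (question_pmf G) (\<lambda>x. table_entry G x y (a x) b)) xs)"

text \<open>Strict, so that for samples of length \<open>m\<close> the failure at one pair is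
  exactly the event in Hoeffding's inequality.\<close>

definition representative :: "free_game \<Rightarrow> (nat \<Rightarrow> nat) \<Rightarrow> real \<Rightarrow> nat list \<Rightarrow> bool" where
  "representative G a \<delta> xs \<longleftrightarrow>
     (\<forall>y<nY G. \<forall>b<nB G. \<bar>deviation G a xs y b\<bar> < real (length xs) * \<delta>)"

text \<open>For each \<open>y\<close>, passing from expectation to sample costs \<delta> at
  \<open>b y\<close>, and returning costs \<delta> at the best response, which the sample prefers.
  Summing over \<open>y\<close>, the strategy \<open>a\<close> is then one candidate for the first
  player.\<close>

lemma response_value_representative:
  assumes G: "is_free_game G" and a: "\<And>x. a x < nA G" and b: "\<And>y. b y < nB G"
    and rep: "representative G a \<delta> xs" and len: "length xs = m" "0 < m"
    and D: "\<And>i. i < m \<Longrightarrow> D i = xs ! i" "\<And>i. i < m \<Longrightarrow> D (m + i) = a (xs ! i)"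
  shows "real (nX G * nY G) * (win_expectation G a b - 2 * \<delta>) \<le>
    response_value G (best_response G m D)"
proof -
  let ?\<beta> = "best_response G m D"
  have X: "0 < nX G" using G by (simp add: is_free_game_def)
  define e where "e y b = measure_pmf.expectation (question_pmf G) (\<lambda>x. table_entry G x y (a x) b)" for y b
  have e: "real (nX G) * e y b = (\<Sum>x<nX G. table_entry G x y (a x) b)" for y b
    using X unfolding e_def question_pmf_def by (subst integral_pmf_of_set) (auto simp: lessThan_empty_iff)
  have S: "sample_sum G m D y b = deviation G a xs y b + real m * e y b" for y b
  proof -
    have "sample_sum G m D y b = sum_list (map (\<lambda>x. table_entry G x y (a x) b) xs)"
      unfolding sample_sum_def sum_list_sum_nth using len D by (simp add: atLeast0LessThan)
    also have "\<dots> = deviation G a xs y b + real (length xs) * e y b"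
      unfolding deviation_def e_def by (induction xs) (auto simp: algebra_simps)
    finally show ?thesis by (simp add: len)
  qed
  have "e y (b y) - 2 * \<delta> \<le> e y (?\<beta> y)" if y: "y < nY G" for y
  proof -
    have "sample_sum G m D y (b y) \<le> sample_sum G m D y (?\<beta> y)"
      unfolding best_response_def by (rule argmax_below_ge) (rule b)
    moreover have "\<bar>deviation G a xs y (b y)\<bar> < real m * \<delta>" "\<bar>deviation G a xs y (?\<beta> y)\<bar> < real m * \<delta>"
      using rep y b best_response_less[OF G] by (auto simp: representative_def len)
    ultimately have "real m * (e y (b y) - 2 * \<delta>) \<le> real m * e y (?\<beta> y)"
      unfolding S by (simp add: algebra_simps)
    then show ?thesis using len by simp
  qed
  then have "(\<Sum>y<nY G. real (nX G) * (e y (b y) - 2 * \<delta>)) \<le> (\<Sum>y<nY G. real (nX G) * e y (?\<beta> y))"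
    by (intro sum_mono mult_left_mono) auto
  also have "\<dots> = (\<Sum>x<nX G. \<Sum>y<nY G. table_entry G x y (a x) (?\<beta> y))"
    unfolding e by (rule sum.swap)
  also have "\<dots> \<le> response_value G ?\<beta>"
    by (rule response_value_ge) (rule a)
  finally have "(\<Sum>y<nY G. real (nX G) * (e y (b y) - 2 * \<delta>)) \<le> response_value G ?\<beta>" .
  moreover have "(\<Sum>y<nY G. real (nX G) * (e y (b y) - 2 * \<delta>)) =
      (\<Sum>y<nY G. real (nX G) * e y (b y)) - real (nX G * nY G) * (2 * \<delta>)"
    by (simp add: right_diff_distrib sum_subtractf)
  moreover have "(\<Sum>y<nY G. real (nX G) * e y (b y)) = real (nX G * nY G) * win_expectation G a b"
    unfolding e win_expectation_eq[OF G a b] by (rule sum.swap)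
  ultimately show ?thesis by (simp add: algebra_simps)
qed

lemma prob_representative:
  assumes G: "is_free_game G" and \<delta>: "\<delta> > 0"
  shows "measure_pmf.prob (replicate_pmf m (question_pmf G)) {xs. representative G a \<delta> xs} \<ge>
    1 - real (nY G * nB G) * (2 * exp (- 2 * real m * \<delta>\<^sup>2))"
proof -
  let ?P = "replicate_pmf m (question_pmf G)"
  let ?bad = "\<lambda>y b. {xs. \<bar>deviation G a xs y b\<bar> \<ge> real m * \<delta>}"
  have "measure_pmf.prob ?P (- {xs. representative G a \<delta> xs}) \<le>
    measure_pmf.prob ?P (\<Union>(y, b)\<in>{..<nY G} \<times> {..<nB G}. ?bad y b)"
    \<comment> \<open>The inclusion of events holds on the support only, where lists have length
      \<open>m\<close>.\<close>
    by (intro measure_pmf.finite_measure_mono_AE)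
       (auto simp: AE_measure_pmf_iff set_replicate_pmf representative_def not_less)
  also have "\<dots> \<le> (\<Sum>(y, b)\<in>{..<nY G} \<times> {..<nB G}. measure_pmf.prob ?P (?bad y b))"
    unfolding case_prod_unfold by (intro measure_pmf.finite_measure_subadditive_finite) auto
  also have "\<dots> \<le> (\<Sum>(y, b)\<in>{..<nY G} \<times> {..<nB G}. 2 * exp (- 2 * real m * \<delta>\<^sup>2))"
    unfolding case_prod_unfold deviation_def
    by (intro sum_mono Hoeffding_replicate_pmf_abs_ge)
       (use G \<delta> in \<open>auto intro: table_entry_nonneg table_entry_le_1\<close>)
  also have "\<dots> = real (nY G * nB G) * (2 * exp (- 2 * real m * \<delta>\<^sup>2))"
    by (simp add: case_prod_unfold card_cartesian_product)
  finally show ?thesis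
    using measure_pmf.prob_compl[of "{xs. representative G a \<delta> xs}" ?P] by (simp add: Compl_eq_Diff_UNIV)
qed

text \<open>Origin of the 8: with \<delta> = \<epsilon>/2 the Hoeffding exponent is m\<epsilon>^2/2,
  at least 4(l + 1). As e^4 \<ge> 13, failure has probability at most 2|Y||B|/13^(l + 1), which is
  at most 1/3 since 6 * 2^l \<le> 13^(l + 1).\<close>

lemma prob_representative_sample:
  assumes G: "is_free_game G" and \<epsilon>: "\<epsilon> > 0" and K: "8 / \<epsilon>\<^sup>2 \<le> real K" and l: "nY G * nB G \<le> 2 ^ l"
  shows "measure_pmf.prob (replicate_pmf (K * Suc l) (question_pmf G))
    {xs. representative G a (\<epsilon> / 2) xs} \<ge> 2/3"
proof -
  let ?N = "real (nY G * nB G)"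
  \<comment> \<open>The quadratic Taylor polynomial at 4 is 1 + 4 + 8.\<close>
  have e4: "exp 4 \<ge> (13::real)" using exp_lower_Taylor_quadratic[of "4 :: real"] by simp
  have "8 \<le> real K * \<epsilon>\<^sup>2" using K \<epsilon> by (simp add: field_simps)
  then have "8 * real (Suc l) \<le> real K * \<epsilon>\<^sup>2 * real (Suc l)" by (intro mult_right_mono) auto
  then have "exp (real (Suc l) * 4) \<le> exp (2 * real (K * Suc l) * (\<epsilon> / 2)\<^sup>2)"
    by (simp add: power_divide algebra_simps)
  moreover have "13 ^ Suc l \<le> exp (4 :: real) ^ Suc l"
    by (intro power_mono e4) simp
  ultimately have "13 ^ Suc l \<le> exp (2 * real (K * Suc l) * (\<epsilon> / 2)\<^sup>2)"
    unfolding exp_of_nat_mult by linarith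
  moreover have "6 * ?N \<le> 13 ^ Suc l"
  proof -
    have "real (nY G * nB G) \<le> real (2 ^ l)" using l by (simp only: of_nat_le_iff)
    then have "?N \<le> 2 ^ l" by simp
    moreover have "(2::real) ^ l \<le> 13 ^ l" by (intro power_mono) auto
    moreover have "(0::real) \<le> 13 ^ l" by simp
    ultimately show ?thesis unfolding power_Suc by linarith
  qed
  ultimately have "6 * ?N \<le> exp (2 * real (K * Suc l) * (\<epsilon> / 2)\<^sup>2)" by linarith
  moreover have "?N * (2 * exp (- t)) \<le> 1 / 3" if "6 * ?N \<le> exp t" for t
    using that unfolding exp_minus by (simp only: field_simps exp_gt_zero) simp
  ultimately have "?N * (2 * exp (- 2 * real (K * Suc l) * (\<epsilon> / 2)\<^sup>2)) \<le> 1 / 3"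
    by (simp only: mult_minus_left)
  then show ?thesis
    using prob_representative[OF G, of "\<epsilon> / 2" "K * Suc l" a] \<epsilon> by linarith
qed

section \<open>Correctness of the two programs\<close>

definition tail_com :: com where
  "tail_com = Seq search_com (block [RDivNat 0 0 0, RDivNat 0 0 1])"

text \<open>The search maximises sums over X and Y; dividing by |X| and then by |Y| turns the
  maximum into a game value.\<close>

lemma wp_tail_com:
  assumes G: "is_free_game G" and s: "initialized G m s" "nmem s 21 = 32 + q" "nmem s 22 = n"
      "nmem s 23 = 0" "rmem s 0 = 0"
    and qn: "q + n = 2 * m" and zero: "\<And>i. i < n \<Longrightarrow> digits s (q + i) = 0"
  shows "wp G tail_com (prod (\<lambda>i. digit_bound G m (q + i)) {..<n} * search_time G m n + 7) (\<lambda>s'.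
    rmem s' 0 \<le> game_value G \<and>
    (\<forall>E. (\<forall>i<q. E i = digits s i) \<longrightarrow> (\<forall>i<n. E (q + i) < digit_bound G m (q + i)) \<longrightarrow>
       response_value G (best_response G m E) \<le> real (nX G * nY G) * rmem s' 0)) s"
proof -
  let ?U = "real (nX G * nY G) * game_value G"
  have XY: "0 < nX G" "0 < nY G" using G by (auto simp: is_free_game_def)
  have "wp G tail_com (Suc ((prod (\<lambda>i. digit_bound G m (q + i)) {..<n} * search_time G m n + 1) +
    (2 * length [RDivNat 0 0 0, RDivNat 0 0 1] + 1))) (\<lambda>s'.
    rmem s' 0 \<le> game_value G \<and>
    (\<forall>E. (\<forall>i<q. E i = digits s i) \<longrightarrow> (\<forall>i<n. E (q + i) < digit_bound G m (q + i)) \<longrightarrow>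
       response_value G (best_response G m E) \<le> real (nX G * nY G) * rmem s' 0)) s"
    unfolding tail_com_def
  proof (rule wp_Seq, rule wp_mono[OF wp_search_com[OF G s qn zero]], assumption)
    show "0 \<le> ?U" by (simp add: game_value_bounds[OF G])
    show "response_value G (best_response G m D) \<le> ?U" for D
      by (intro response_value_le G best_response_less)
  next
    fix s' assume s': "initialized G m s' \<and> rmem s' 0 \<le> ?U \<and> (\<forall>E. (\<forall>i<q. E i = digits s i) \<longrightarrow>
      (\<forall>i<n. E (q + i) < digit_bound G m (q + i)) \<longrightarrow> response_value G (best_response G m E) \<le> rmem s' 0)"
    let ?s = "fold (det_exec G) [RDivNat 0 0 0, RDivNat 0 0 1] s'"
    have r: "rmem s' 0 = real (nX G * nY G) * rmem ?s 0"
      using s' XY by (simp add: initialized_def)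
    have "real (nX G * nY G) * rmem ?s 0 \<le> ?U"
      using s' r by metis
    moreover have "0 < real (nX G * nY G)"
      using XY by simp
    ultimately have "rmem ?s 0 \<le> game_value G"
      using mult_le_cancel_left_pos by blast
    then show "wp G (block [RDivNat 0 0 0, RDivNat 0 0 1]) (2 * length [RDivNat 0 0 0, RDivNat 0 0 1] + 1)
      (\<lambda>s'. rmem s' 0 \<le> game_value G \<and>
        (\<forall>E. (\<forall>i<q. E i = digits s i) \<longrightarrow> (\<forall>i<n. E (q + i) < digit_bound G m (q + i)) \<longrightarrow>
         response_value G (best_response G m E) \<le> real (nX G * nY G) * rmem s' 0)) s'"
      using s' unfolding r by (intro wp_block) auto
  qed simp
  then show ?thesis by (rule wp_mono) auto
qed

definition accurate :: "free_game \<Rightarrow> real \<Rightarrow> state \<Rightarrow> bool" where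
  "accurate G \<epsilon> s \<longleftrightarrow> \<bar>rmem s 0 - game_value G\<bar> \<le> \<epsilon>"

text \<open>\<open>D\<close> is the one guess that must be among those tried: a representative
  sample followed by the optimal answers to it.\<close>

lemma accurateI:
  assumes G: "is_free_game G"
    and a: "\<forall>x. a x < nA G" and b: "\<forall>y. b y < nB G" and v: "game_value G = win_expectation G a b"
    and rep: "representative G a (\<epsilon> / 2) xs" and len: "length xs = m" "0 < m" and \<epsilon>: "0 < \<epsilon>"
    and D: "\<And>i. i < m \<Longrightarrow> D i = xs ! i" "\<And>i. i < m \<Longrightarrow> D (m + i) = a (xs ! i)"
    and le: "response_value G (best_response G m D) \<le> real (nX G * nY G) * rmem s 0"
    and ub: "rmem s 0 \<le> game_value G"
  shows "accurate G \<epsilon> s"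
proof -
  have "real (nX G * nY G) * (win_expectation G a b - 2 * (\<epsilon> / 2)) \<le>
      response_value G (best_response G m D)"
    by (rule response_value_representative[OF G _ _ rep len D]) (use a b in auto)
  also note le
  finally have "win_expectation G a b - \<epsilon> \<le> rmem s 0"
    using G by (simp add: is_free_game_def mult_le_cancel_left)
  then show ?thesis using ub \<epsilon> by (simp add: accurate_def v)
qed

definition deterministic_com :: "nat \<Rightarrow> com" where
  "deterministic_com K = Seq (setup_com K) (Seq (block [NMove 21 5, NAdd 22 6 6]) tail_com)"

lemma deterministic_deterministic_com: "deterministic (deterministic_com K)"
  by (simp add: deterministic_com_def setup_com_def double_com_def tail_com_def search_com_def
    evaluate_com_def question_com_def answer_com_def response_com_def sum_com_def increment_com_def)

lemma prod_digit_bound: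
  "prod (digit_bound G m) {..<2 * m} = (nX G * nA G) ^ m"
  "prod (\<lambda>i. digit_bound G m (m + i)) {..<m} = nA G ^ m"
proof -
  have "prod (digit_bound G m) {..<m + k} = nX G ^ m * nA G ^ k" for k
    by (induction k) (simp_all add: digit_bound_def)
  then show "prod (digit_bound G m) {..<2 * m} = (nX G * nA G) ^ m"
    by (simp add: mult_2 power_mult_distrib)
qed (simp add: digit_bound_def)

lemma wp_deterministic_com:
  assumes G: "is_free_game G" and \<epsilon>: "\<epsilon> > 0" and K: "8 / \<epsilon>\<^sup>2 \<le> real K"
  obtains l m where "m = K * Suc l" "2 ^ l \<le> 4 * (nY G * nB G)"
    "wp G (deterministic_com K)
      (nY G * 6 + nB G * 6 + 39 + (nX G * nA G) ^ m * search_time G m (2 * m))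
      (accurate G \<epsilon>) (initial_state G)"
proof -
  obtain l s where l: "nY G * nB G \<le> 2 ^ l" "2 ^ l \<le> 4 * (nY G * nB G)"
    and s: "initialized G (K * Suc l) s" "rmem s = (\<lambda>_. 0)" "\<And>j. j = 11 \<or> 18 \<le> j \<Longrightarrow> nmem s j = 0"
    "wp G (setup_com K) (nY G * 6 + nB G * 6 + 25) ((=) s) (initial_state G)"
    using G by (rule wp_setup_com) (rule that)
  define m where "m = K * Suc l"
  have "0 < 8 / \<epsilon>\<^sup>2" using \<epsilon> by simp
  then have m: "0 < m" using K by (cases K) (auto simp: m_def)
  obtain a b where ab: "\<forall>x. a x < nA G" "\<forall>y. b y < nB G" "game_value G = win_expectation G a b"
    using G by (rule game_value_attained)
  \<comment> \<open>Probabilistic method: positive probability yields a representative sample, which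
    the enumeration of all questions is bound to meet.\<close>
  have "measure_pmf.prob (replicate_pmf m (question_pmf G)) {xs. representative G a (\<epsilon> / 2) xs} \<noteq> 0"
    using prob_representative_sample[OF G \<epsilon> K l(1), of a] by (simp add: m_def)
  then have "set_pmf (replicate_pmf m (question_pmf G)) \<inter> {xs. representative G a (\<epsilon> / 2) xs} \<noteq> {}"
    by (simp add: measure_pmf_zero_iff)
  then obtain xs where xs: "representative G a (\<epsilon> / 2) xs" "length xs = m"
    "set xs \<subseteq> set_pmf (question_pmf G)"
    by (auto simp: set_replicate_pmf)
  have X: "0 < nX G" using G by (simp add: is_free_game_def)
  then have xsX: "xs ! i < nX G" if "i < m" for i
    using subsetD[OF xs(3), of "xs ! i"] xs(2) that X
    by (simp add: question_pmf_def lessThan_empty_iff)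
  define E where "E i = (if i < m then xs ! i else a (xs ! (i - m)))" for i
  define s1 where "s1 = fold (det_exec G) [NMove 21 5, NAdd 22 6 6] s"
  have "wp G (deterministic_com K) (Suc ((nY G * 6 + nB G * 6 + 25) +
      Suc ((2 * length [NMove 21 5, NAdd 22 6 6] + 1) +
       (prod (\<lambda>i. digit_bound G m (0 + i)) {..<2 * m} * search_time G m (2 * m) + 7))))
      (accurate G \<epsilon>) (initial_state G)"
    unfolding deterministic_com_def
  proof (rule wp_Seq, rule wp_mono[OF s(4)], rule le_refl, intro wp_Seq wp_block, simp)
    fix s' assume "s = s'"
    have s1': "initialized G m s1" "nmem s1 21 = 32 + 0" "nmem s1 22 = 2 * m"
      "nmem s1 23 = 0" "rmem s1 0 = 0"
      using s(1-3) by (simp_all add: s1_def m_def initialized_def)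
    have "wp G tail_com (prod (\<lambda>i. digit_bound G m (0 + i)) {..<2 * m} * search_time G m (2 * m) + 7)
      (accurate G \<epsilon>) s1"
    proof (rule wp_mono[OF wp_tail_com[OF G s1']])
      fix s'' :: state assume s'': "rmem s'' 0 \<le> game_value G \<and>
        (\<forall>E. (\<forall>i<0. E i = digits s1 i) \<longrightarrow> (\<forall>i<2 * m. E (0 + i) < digit_bound G m (0 + i)) \<longrightarrow>
         response_value G (best_response G m E) \<le> real (nX G * nY G) * rmem s'' 0)"
      have "E (0 + i) < digit_bound G m (0 + i)" if "i < 2 * m" for i
        using ab(1) xsX by (auto simp: E_def digit_bound_def)
      with s'' show "accurate G \<epsilon> s''"
        by (intro accurateI[OF G ab xs(1,2) m \<epsilon>, of E]) (auto simp: E_def)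
    qed (use s(3) in \<open>auto simp: s1_def digits_def\<close>)
    then show "wp G tail_com (prod (\<lambda>i. digit_bound G m (0 + i)) {..<2 * m} * search_time G m (2 * m) + 7)
      (accurate G \<epsilon>) (fold (det_exec G) [NMove 21 5, NAdd 22 6 6] s')"
      by (simp add: s1_def \<open>s = s'\<close>)
  qed
  then have "wp G (deterministic_com K)
      (nY G * 6 + nB G * 6 + 39 + (nX G * nA G) ^ m * search_time G m (2 * m))
      (accurate G \<epsilon>) (initial_state G)"
    by (rule wp_mono) (auto simp: prod_digit_bound)
  with m_def l(2) show thesis by (rule that)
qed

lemma steps_Seq: "steps G (Suc n) (Seq c d # cs, s) = steps G n (c # d # cs, s)"
  by (simp add: bind_return_pmf)

text \<open>Starting the counter at address \<open>32 + m\<close> with \<open>m\<close> digits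
  leaves the sampled questions untouched.\<close>

definition randomized_com :: "nat \<Rightarrow> com" where
  "randomized_com K = Seq (setup_com K)
     (Seq sample_com (Seq (block [NMove 21 7, NMove 22 6]) tail_com))"

lemma randomized_com:
  assumes G: "is_free_game G" and \<epsilon>: "\<epsilon> > 0" and K: "8 / \<epsilon>\<^sup>2 \<le> real K"
  obtains l m t where "m = K * Suc l" "2 ^ l \<le> 4 * (nY G * nB G)"
    "t \<le> nY G * 6 + nB G * 6 + 41 + 10 * m + nA G ^ m * search_time G m m"
    "\<forall>c \<in> set_pmf (run (randomized_com K) G t). halted c"
    "measure_pmf.prob (run (randomized_com K) G t) {c. \<bar>result c - game_value G\<bar> \<le> \<epsilon>} \<ge> 2/3"
proof -
  obtain l s where l: "nY G * nB G \<le> 2 ^ l" "2 ^ l \<le> 4 * (nY G * nB G)"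
    and s: "initialized G (K * Suc l) s" "rmem s = (\<lambda>_. 0)" "\<And>j. j = 11 \<or> 18 \<le> j \<Longrightarrow> nmem s j = 0"
    "wp G (setup_com K) (nY G * 6 + nB G * 6 + 25) ((=) s) (initial_state G)"
    using G by (rule wp_setup_com) (rule that)
  define m where "m = K * Suc l"
  have "0 < 8 / \<epsilon>\<^sup>2" using \<epsilon> by simp
  then have m: "0 < m" using K by (cases K) (auto simp: m_def)
  obtain a b where ab: "\<forall>x. a x < nA G" "\<forall>y. b y < nB G" "game_value G = win_expectation G a b"
    using G by (rule game_value_attained)
  have X: "0 < nX G" using G by (simp add: is_free_game_def)
  let ?P = "replicate_pmf m (question_pmf G)"
  let ?c = "Seq (block [NMove 21 7, NMove 22 6]) tail_com"
  let ?T = "Suc ((2 * length [NMove 21 7, NMove 22 6] + 1) + (nA G ^ m * search_time G m m + 7))"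
  from s(4) obtain k where k: "k \<le> nY G * 6 + nB G * 6 + 25"
    "\<forall>cs. steps G k (setup_com K # cs, initial_state G) = return_pmf (cs, s)"
    by (rule wpE) auto
  have "\<exists>s'. steps G ?T ([?c], fold (put_sample G) xs s) = return_pmf ([], s') \<and>
    (representative G a (\<epsilon> / 2) xs \<longrightarrow> accurate G \<epsilon> s')" if xs: "xs \<in> set_pmf ?P" for xs
  proof -
    have len: "length xs = m" and "set xs \<subseteq> {..<nX G}"
      using xs X by (auto simp: set_replicate_pmf question_pmf_def lessThan_empty_iff)
    define s1 where "s1 = fold (put_sample G) xs s"
    define s2 where "s2 = fold (det_exec G) [NMove 21 7, NMove 22 6] s1"
    note F = fold_put_sample[OF s(1), where xs = xs]
    have s1: "initialized G m s1" "nmem s1 23 = 0" "rmem s1 0 = 0"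
      using F(1,2) F(3)[of 23] s(2,3) by (simp_all add: s1_def m_def)
    have dig: "digits s1 i = xs ! i" if "i < m" for i
      using F(4)[of i] that s(3)[of 11] by (simp add: digits_def s1_def len)
    have dig0: "digits s1 (m + i) = 0" for i
      using F(3)[of "32 + (m + i)"] s(3) by (simp add: digits_def s1_def len)
    have s2: "initialized G m s2" "nmem s2 21 = 32 + m" "nmem s2 22 = m" "nmem s2 23 = 0" "rmem s2 0 = 0"
      using s1 by (simp_all add: s2_def initialized_def)
    have digits: "digits s2 = digits s1"
      by (simp add: s2_def digits_def fun_eq_iff)
    define E where "E i = (if i < m then xs ! i else a (xs ! (i - m)))" for i
    have "wp G ?c ?T (\<lambda>s'. representative G a (\<epsilon> / 2) xs \<longrightarrow> accurate G \<epsilon> s') s1"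
    proof (intro wp_Seq wp_block, simp, fold s2_def prod_digit_bound(2)[of G m],
        rule wp_mono[OF wp_tail_com[OF G s2]])
      fix s' :: state assume s': "rmem s' 0 \<le> game_value G \<and>
        (\<forall>E. (\<forall>i<m. E i = digits s2 i) \<longrightarrow> (\<forall>i<m. E (m + i) < digit_bound G m (m + i)) \<longrightarrow>
         response_value G (best_response G m E) \<le> real (nX G * nY G) * rmem s' 0)"
      have "E (m + i) < digit_bound G m (m + i)" for i
        using ab(1) by (simp add: E_def digit_bound_def)
      moreover have "E i = digits s2 i" if "i < m" for i
        using that by (simp add: E_def digits dig)
      ultimately have "response_value G (best_response G m E) \<le> real (nX G * nY G) * rmem s' 0"
        using s' by blast
      then show "representative G a (\<epsilon> / 2) xs \<longrightarrow> accurate G \<epsilon> s'"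
        using s' by (intro impI accurateI[OF G ab _ len m \<epsilon>, of E]) (auto simp: E_def)
    qed (use dig0 in \<open>auto simp: digits\<close>)
    then obtain k' s' where k': "\<forall>cs. steps G k' (?c # cs, s1) = return_pmf (cs, s')" "k' \<le> ?T"
      "representative G a (\<epsilon> / 2) xs \<longrightarrow> accurate G \<epsilon> s'" by (rule wpE)
    \<comment> \<open>The halting time \<open>k'\<close> depends on the sample. Halted
      configurations stay put, so all runs can be extended to the common time
      \<open>?T\<close>.\<close>
    have "steps G (k' + (?T - k')) ([?c], s1) = return_pmf ([], s')"
      unfolding steps_add using k'(1) by (simp add: bind_return_pmf)
    then show ?thesis using k'(2,3) by (auto simp: s1_def)
  qed
  then obtain f where f: "\<And>xs. xs \<in> set_pmf ?P \<Longrightarrow>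
      steps G ?T ([?c], fold (put_sample G) xs s) = return_pmf ([], f xs)"
    "\<And>xs. xs \<in> set_pmf ?P \<Longrightarrow> representative G a (\<epsilon> / 2) xs \<Longrightarrow> accurate G \<epsilon> (f xs)"
    by metis
  define t where "t = Suc (k + Suc ((10 * m + 1) + ?T))"
  have "run (randomized_com K) G t =
      bind_pmf (steps G (10 * m + 1) (sample_com # [?c], s)) (steps G ?T)"
    using k(2) unfolding run_def randomized_com_def t_def steps_Seq
    by (simp only: steps_add steps_Seq bind_return_pmf)
  also have "\<dots> = bind_pmf ?P (\<lambda>xs. steps G ?T ([?c], fold (put_sample G) xs s))"
    by (subst steps_sample_com[OF s(1)])
       (use s(3) X in \<open>auto simp: m_def question_pmf_def bind_map_pmf\<close>)
  also have "\<dots> = map_pmf (\<lambda>xs. ([], f xs)) ?P"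
    unfolding map_pmf_def by (intro bind_pmf_cong refl f(1))
  finally have run: "run (randomized_com K) G t = map_pmf (\<lambda>xs. ([], f xs)) ?P" .
  have "2/3 \<le> measure_pmf.prob ?P {xs. representative G a (\<epsilon> / 2) xs}"
    using prob_representative_sample[OF G \<epsilon> K l(1), of a] by (simp add: m_def)
  also have "\<dots> \<le> measure_pmf.prob ?P {xs. accurate G \<epsilon> (f xs)}"
    by (intro measure_pmf.finite_measure_mono_AE) (auto simp: AE_measure_pmf_iff f(2))
  finally have "measure_pmf.prob (run (randomized_com K) G t) {c. \<bar>result c - game_value G\<bar> \<le> \<epsilon>} \<ge> 2/3"
    unfolding run by (simp add: vimage_def result_def accurate_def)
  moreover have "\<forall>c \<in> set_pmf (run (randomized_com K) G t). halted c"
    unfolding run by (auto simp: halted_def)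
  moreover have "t \<le> nY G * 6 + nB G * 6 + 41 + 10 * m + nA G ^ m * search_time G m m"
    using k(1) by (simp add: t_def)
  ultimately show thesis using that m_def l(2) by blast
qed

section \<open>Time bounds\<close>

text \<open>All sizes are at least 1, so every summand is charged to the full product: 16 + 17 + 18
  + 15 + 14 = 80 for the nested loops, and 2 * 26 + 21 = 73 for the rest.\<close>

lemma search_time_le:
  assumes G: "is_free_game G" and m: "0 < m" and n: "n \<le> 2 * m"
  shows "search_time G m n \<le> 153 * (nX G * nA G * (nY G * nB G) * m)"
proof -
  have pos: "1 \<le> nX G" "1 \<le> nY G" "1 \<le> nA G" "1 \<le> nB G" "1 \<le> m"
    using G m by (auto simp: is_free_game_def)
  define p1 where "p1 = nB G * m"
  define p2 where "p2 = nY G * p1"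
  define p3 where "p3 = nA G * p2"
  define p4 where "p4 = nX G * p3"
  have p: "nB G \<le> p1" "1 \<le> p1" "1 \<le> p2" "1 \<le> p3" "m \<le> p4" "1 \<le> p4"
    using pos by (auto simp: p1_def p2_def p3_def p4_def)
  have "nB G * (16 * m + 17) + 18 = 16 * p1 + 17 * nB G + 18"
    by (simp add: p1_def algebra_simps)
  also have "\<dots> \<le> 51 * p1" using p by linarith
  finally have "nY G * (nB G * (16 * m + 17) + 18) \<le> nY G * (51 * p1)" by (rule mult_le_mono2)
  also have "\<dots> = 51 * p2" by (simp add: p2_def)
  finally have "nY G * (nB G * (16 * m + 17) + 18) + 15 \<le> 66 * p2" using p by linarith
  then have "nA G * (nY G * (nB G * (16 * m + 17) + 18) + 15) \<le> nA G * (66 * p2)" by (rule mult_le_mono2)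
  also have "\<dots> = 66 * p3" by (simp add: p3_def)
  finally have "nA G * (nY G * (nB G * (16 * m + 17) + 18) + 15) + 14 \<le> 80 * p3" using p by linarith
  then have "nX G * (nA G * (nY G * (nB G * (16 * m + 17) + 18) + 15) + 14) \<le> nX G * (80 * p3)"
    by (rule mult_le_mono2)
  also have "\<dots> = 80 * p4" by (simp add: p4_def)
  finally have "search_time G m n \<le> 153 * p4" using p n unfolding search_time_def by linarith
  then show ?thesis by (simp add: p1_def p2_def p3_def p4_def mult_ac)
qed

lemma total_time_le:
  assumes G: "is_free_game G" and m: "0 < m" and n: "n \<le> 2 * m" and N: "0 < N"
  shows "nY G * 6 + nB G * 6 + 41 + 10 * m + N ^ m * search_time G m n \<le>
    216 * (N ^ m * (nX G * nA G * (nY G * nB G) * m))"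
proof -
  define p where "p = nX G * nA G * (nY G * nB G) * m"
  have pos: "1 \<le> nX G" "1 \<le> nY G" "1 \<le> nA G" "1 \<le> nB G" "1 \<le> m"
    using G m by (auto simp: is_free_game_def)
  then have "nY G \<le> p" "nB G \<le> p" "m \<le> p" "1 \<le> p"
    by (auto simp: p_def)
  moreover have "p \<le> N ^ m * p" using N by simp
  moreover have "N ^ m * search_time G m n \<le> N ^ m * (153 * p)"
    unfolding p_def by (intro mult_le_mono2 search_time_le assms)
  then have "N ^ m * search_time G m n \<le> 153 * (N ^ m * p)" by simp
  \<comment> \<open>The total is 6 + 6 + 41 + 10 + 153 = 216.\<close>
  ultimately show ?thesis unfolding p_def[symmetric] by linarith
qed

text \<open>With q = L/\<epsilon>^2, the bounds \<open>K\<close> \<le> 9/\<epsilon>^2 and l + 1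
  \<le> 3 + L \<le> 4L give \<open>m\<close> \<le> 36q. The powers of \<open>M\<close> are then 36q
  for \<open>N ^ m\<close>, q each for \<open>M\<close> and \<open>Z\<close>, and 2q for the factor
  \<open>m\<close>: 40q in all.\<close>

lemma quasipolynomial_bound:
  fixes M \<epsilon> :: real and N Z K l m :: nat
  assumes \<epsilon>: "0 < \<epsilon>" "\<epsilon> < 1" and M: "2 \<le> M" "real N \<le> M" and Z: "0 < Z"
    and K: "K = nat \<lceil>8 / \<epsilon>\<^sup>2\<rceil>" and l: "2 ^ l \<le> 4 * Z" and m: "m = K * Suc l"
  shows "real N ^ m * (M * (real Z * real m)) \<le> 36 * M powr (40 * log 2 (at_least_2 Z) / \<epsilon>\<^sup>2)"
proof -
  define L where "L = log 2 (at_least_2 Z)"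
  define q where "q = L / \<epsilon>\<^sup>2"
  have Z2: "2 \<le> at_least_2 Z" "real Z \<le> at_least_2 Z" by (auto simp: at_least_2_def)
  then have L1: "1 \<le> L" by (simp add: L_def le_log_iff)
  have \<epsilon>2: "0 < \<epsilon>\<^sup>2" "\<epsilon>\<^sup>2 \<le> 1" using \<epsilon> by (auto intro: power_le_one)
  have q: "L \<le> q" using \<epsilon>2 L1 mult_left_mono[of "\<epsilon>\<^sup>2" 1 L] by (simp add: q_def field_simps)
  with L1 have q1: "1 \<le> q" by simp
  have "real (2 ^ l) \<le> real (4 * Z)" using l by (simp only: of_nat_le_iff)
  then have "(2::real) ^ l \<le> 4 * at_least_2 Z" using Z2 by simp
  then have "log 2 (2 ^ l) \<le> log 2 (4 * at_least_2 Z)" by (intro log_mono) auto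
  also have "\<dots> = 2 + L" using Z2 log_powr_cancel[of 2 2] by (simp add: log_mult L_def)
  finally have l4: "real (Suc l) \<le> 4 * L" using L1 by (simp add: log_nat_power)
  have "1 \<le> 1 / \<epsilon>\<^sup>2" using \<epsilon>2 by simp
  moreover have "real K \<le> 8 / \<epsilon>\<^sup>2 + 1" unfolding K using zero_le_divide_iff[of 8 "\<epsilon>\<^sup>2"] \<epsilon>2 by linarith
  ultimately have K9: "real K \<le> 9 / \<epsilon>\<^sup>2" by simp
  have "real m \<le> 9 / \<epsilon>\<^sup>2 * (4 * L)"
    unfolding m of_nat_mult using K9 l4 L1 \<epsilon>2 by (intro mult_mono) auto
  then have mq: "real m \<le> 36 * q" by (simp add: q_def)
  have M0: "0 < M" "1 \<le> M" using M by auto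
  have "real N ^ m \<le> M ^ m" using M by (intro power_mono) auto
  also have "\<dots> = M powr real m" using M0 by (simp add: powr_realpow)
  also have "\<dots> \<le> M powr (36 * q)" using M0 mq by (intro powr_mono) auto
  finally have 1: "real N ^ m \<le> M powr (36 * q)" .
  have "M = M powr 1" using M0 by simp
  also have "\<dots> \<le> M powr q" using M0 q1 by (intro powr_mono) auto
  finally have 2: "M \<le> M powr q" .
  have "real Z \<le> 2 powr L" using Z2 by (simp add: L_def)
  also have "\<dots> \<le> 2 powr q" using q by (intro powr_mono) auto
  also have "\<dots> \<le> M powr q" using M q1 by (intro powr_mono2) auto
  finally have 3: "real Z \<le> M powr q" .
  \<comment> \<open>A linear factor is absorbed into 2^(2q), using 2 ln 2 \<ge> 4/3 > 1.\<close>
  have "q \<le> exp (2 * q * ln 2)"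
  proof -
    have "q * 1 \<le> q * (2 * ln 2)" using ln2_ge_two_thirds q1 by (intro mult_left_mono) auto
    also have "\<dots> = 2 * q * ln 2" by simp
    also have "\<dots> \<le> exp (2 * q * ln 2)" using exp_ge_add_one_self[of "2 * q * ln 2"] by linarith
    finally show ?thesis by simp
  qed
  also have "\<dots> = 2 powr (2 * q)" by (simp add: powr_def)
  also have "\<dots> \<le> M powr (2 * q)" using M q1 by (intro powr_mono2) auto
  finally have 4: "real m \<le> 36 * M powr (2 * q)" using mq by linarith
  have "real N ^ m * (M * (real Z * real m)) \<le>
      M powr (36 * q) * (M powr q * (M powr q * (36 * M powr (2 * q))))"
    using 1 2 3 4 M0 by (intro mult_mono) auto
  also have "\<dots> = 36 * M powr (36 * q + (q + (q + 2 * q)))"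
    unfolding powr_add by (simp only: mult_ac)
  finally show ?thesis by (simp add: q_def L_def)
qed

lemma estimates_value_withinI:
  assumes "wp G P t (accurate G \<epsilon>) (initial_state G)" "real t \<le> T" "p \<le> 1"
  shows "estimates_value_within P G T \<epsilon> p"
proof -
  from assms(1) obtain k s where k: "\<forall>cs. steps G k (P # cs, initial_state G) = return_pmf (cs, s)"
    "k \<le> t" "accurate G \<epsilon> s" by (rule wpE)
  then have "run P G k = return_pmf ([], s)" by (simp add: run_def)
  with k assms show ?thesis
    unfolding estimates_value_within_def
    by (intro exI[of _ k]) (auto simp: halted_def result_def accurate_def indicator_def)
qed

text \<open>Real cell 0 starts at 0, and every game value lies in the unit interval.\<close>

lemma Skip_estimates_value_within:
  assumes "is_free_game G" "1 \<le> \<epsilon>" "1 \<le> T" "p \<le> 1"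
  shows "estimates_value_within Skip G T \<epsilon> p"
  by (rule estimates_value_withinI[OF wp_Skip])
     (use game_value_bounds[OF assms(1)] assms in \<open>auto simp: accurate_def initial_state_def\<close>)

lemma at_least_2: "2 \<le> at_least_2 n" "real n \<le> at_least_2 n"
  by (auto simp: at_least_2_def)

lemma at_least_2_mono: "m \<le> n \<Longrightarrow> at_least_2 m \<le> at_least_2 n"
  by (auto simp: at_least_2_def)

lemma one_le_powr_log: "1 \<le> at_least_2 m powr (7776 * log 2 (at_least_2 n) / \<epsilon>\<^sup>2)"
proof -
  have "0 \<le> log 2 (at_least_2 n)" using at_least_2(1)[of n] by (simp add: zero_le_log_cancel_iff)
  then show ?thesis using at_least_2(1)[of m] by (intro ge_one_powr_ge_zero) auto
qed

text \<open>A time bound uses the same \<open>C\<close> as factor and in the exponent, so 40 is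
  raised to 7776 = 216 * 36, the product of the two leading constants.\<close>

lemma powr_40_le:
  "at_least_2 m powr (40 * log 2 (at_least_2 n) / \<epsilon>\<^sup>2) \<le>
   at_least_2 m powr (7776 * log 2 (at_least_2 n) / \<epsilon>\<^sup>2)"
proof -
  have "0 \<le> log 2 (at_least_2 n)" using at_least_2(1)[of n] by (simp add: zero_le_log_cancel_iff)
  then show ?thesis using at_least_2(1)[of m] by (intro powr_mono divide_right_mono) auto
qed

lemma deterministic_com_solves:
  assumes \<epsilon>: "0 < \<epsilon>" "\<epsilon> < 1"
  shows "solves_deterministically (deterministic_com (nat \<lceil>8 / \<epsilon>\<^sup>2\<rceil>)) \<epsilon> (deterministic_time 7776 \<epsilon>)"
  unfolding solves_deterministically_def
proof (intro conjI allI impI deterministic_deterministic_com)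
  fix G assume G: "is_free_game G"
  define K where "K = nat \<lceil>8 / \<epsilon>\<^sup>2\<rceil>"
  have K: "8 / \<epsilon>\<^sup>2 \<le> real K" unfolding K_def by linarith
  have "0 < 8 / \<epsilon>\<^sup>2" using \<epsilon> by simp
  then have K0: "0 < K" using K by (cases K) auto
  obtain l m where m: "m = K * Suc l" "2 ^ l \<le> 4 * (nY G * nB G)"
    and wp: "wp G (deterministic_com K)
      (nY G * 6 + nB G * 6 + 39 + (nX G * nA G) ^ m * search_time G m (2 * m))
      (accurate G \<epsilon>) (initial_state G)" (is "wp G _ ?t _ _")
    using wp_deterministic_com[OF G \<epsilon>(1) K] .
  define N Z where "N = nX G * nA G" and "Z = nY G * nB G"
  have pos: "0 < N" "0 < Z" using G by (auto simp: N_def Z_def is_free_game_def)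
  have m0: "0 < m" using K0 m by simp
  have "?t \<le> 216 * (N ^ m * (N * Z * m))"
    using total_time_le[OF G m0 le_refl pos(1)] unfolding N_def Z_def by linarith
  then have "real ?t \<le> real (216 * (N ^ m * (N * Z * m)))" by (simp only: of_nat_le_iff)
  also have "\<dots> = 216 * (real N ^ m * (real N * (real Z * real m)))" by simp
  also have "\<dots> \<le> 216 * (real N ^ m * (at_least_2 N * (real Z * real m)))"
    using at_least_2(2)[of N] by (intro mult_left_mono mult_right_mono) auto
  also have "real N ^ m * (at_least_2 N * (real Z * real m)) \<le>
      36 * at_least_2 N powr (40 * log 2 (at_least_2 Z) / \<epsilon>\<^sup>2)"
    by (rule quasipolynomial_bound[OF \<epsilon> at_least_2 pos(2) K_def _ m(1)]) (use m in \<open>simp add: Z_def\<close>)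
  also have "216 * (36 * at_least_2 N powr (40 * log 2 (at_least_2 Z) / \<epsilon>\<^sup>2)) \<le>
    deterministic_time 7776 \<epsilon> G"
    using powr_40_le[of N Z \<epsilon>] by (simp add: deterministic_time_def N_def Z_def)
  finally have "real ?t \<le> deterministic_time 7776 \<epsilon> G" by simp
  then show "estimates_value_within (deterministic_com (nat \<lceil>8 / \<epsilon>\<^sup>2\<rceil>)) G (deterministic_time 7776 \<epsilon> G) \<epsilon> 1"
    using wp unfolding K_def by (intro estimates_value_withinI) auto
qed

lemma randomized_com_solves:
  assumes \<epsilon>: "0 < \<epsilon>" "\<epsilon> < 1"
  shows "solves_randomized (randomized_com (nat \<lceil>8 / \<epsilon>\<^sup>2\<rceil>)) \<epsilon> (randomized_time 7776 \<epsilon>)"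
  unfolding solves_randomized_def
proof (intro allI impI)
  fix G assume G: "is_free_game G"
  define K where "K = nat \<lceil>8 / \<epsilon>\<^sup>2\<rceil>"
  have K: "8 / \<epsilon>\<^sup>2 \<le> real K" unfolding K_def by linarith
  have "0 < 8 / \<epsilon>\<^sup>2" using \<epsilon> by simp
  then have K0: "0 < K" using K by (cases K) auto
  obtain l m t where m: "m = K * Suc l" "2 ^ l \<le> 4 * (nY G * nB G)"
    and t: "t \<le> nY G * 6 + nB G * 6 + 41 + 10 * m + nA G ^ m * search_time G m m"
      "\<forall>c \<in> set_pmf (run (randomized_com K) G t). halted c"
      "measure_pmf.prob (run (randomized_com K) G t) {c. \<bar>result c - game_value G\<bar> \<le> \<epsilon>} \<ge> 2/3"
    using randomized_com[OF G \<epsilon>(1) K] .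
  define N Z where "N = nA G" and "Z = nY G * nB G"
  have pos: "0 < N" "0 < Z" using G by (auto simp: N_def Z_def is_free_game_def)
  have m0: "0 < m" using K0 m by simp
  have "t \<le> 216 * (N ^ m * (nX G * N * Z * m))"
    using total_time_le[OF G m0 _ pos(1), of m] t(1) unfolding N_def Z_def by linarith
  then have "real t \<le> real (216 * (N ^ m * (nX G * N * Z * m)))" by (simp only: of_nat_le_iff)
  also have "\<dots> = 216 * nX G * (real N ^ m * (real N * (real Z * real m)))" by simp
  also have "\<dots> \<le> 216 * nX G * (real N ^ m * (at_least_2 N * (real Z * real m)))"
    using at_least_2(2)[of N] by (intro mult_left_mono mult_right_mono) auto
  also have "\<dots> \<le> 216 * nX G * (36 * at_least_2 N powr (40 * log 2 (at_least_2 Z) / \<epsilon>\<^sup>2))"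
    by (intro mult_left_mono quasipolynomial_bound[OF \<epsilon> at_least_2 pos(2) K_def _ m(1)])
       (use m in \<open>simp_all add: Z_def\<close>)
  also have "\<dots> \<le> 216 * nX G * (36 * at_least_2 N powr (7776 * log 2 (at_least_2 Z) / \<epsilon>\<^sup>2))"
    by (intro mult_left_mono powr_40_le) auto
  also have "\<dots> = randomized_time 7776 \<epsilon> G"
    by (simp add: randomized_time_def N_def Z_def)
  finally show "estimates_value_within (randomized_com (nat \<lceil>8 / \<epsilon>\<^sup>2\<rceil>)) G (randomized_time 7776 \<epsilon> G) \<epsilon> (2/3)"
    using t unfolding K_def estimates_value_within_def by blast
qed

lemma deterministic_time_le_quasipoly_time:
  assumes "is_free_game G"
  shows "deterministic_time 7776 \<epsilon> G \<le> quasipoly_time 7776 \<epsilon> G"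
proof -
  have "nX G * nA G \<le> input_size G" "nY G * nB G \<le> input_size G"
    using assms by (auto simp: input_size_def is_free_game_def)
  then have le: "at_least_2 (nX G * nA G) \<le> at_least_2 (input_size G)"
    "log 2 (at_least_2 (nY G * nB G)) \<le> log 2 (at_least_2 (input_size G))"
    using at_least_2_mono at_least_2(1)[of "nY G * nB G"] by (auto intro!: log_mono)
  have ge: "0 \<le> log 2 (at_least_2 (nY G * nB G))" "1 \<le> at_least_2 (input_size G)"
    "0 \<le> at_least_2 (nX G * nA G)"
    using at_least_2(1)[of "nY G * nB G"] at_least_2(1)[of "input_size G"]
      at_least_2(1)[of "nX G * nA G"] by (simp_all add: zero_le_log_cancel_iff)
  have "at_least_2 (nX G * nA G) powr (7776 * log 2 (at_least_2 (nY G * nB G)) / \<epsilon>\<^sup>2) \<le>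
    at_least_2 (input_size G) powr (7776 * log 2 (at_least_2 (nY G * nB G)) / \<epsilon>\<^sup>2)"
    using le ge by (intro powr_mono2) auto
  also have "\<dots> \<le> at_least_2 (input_size G) powr (7776 * log 2 (at_least_2 (input_size G)) / \<epsilon>\<^sup>2)"
    using le ge by (intro powr_mono divide_right_mono mult_left_mono) auto
  finally show ?thesis by (simp add: deterministic_time_def quasipoly_time_def)
qed

lemma solves_deterministically_mono:
  assumes "solves_deterministically P \<epsilon> T" "\<And>G. is_free_game G \<Longrightarrow> T G \<le> T' G"
  shows "solves_deterministically P \<epsilon> T'"
  using assms unfolding solves_deterministically_def estimates_value_within_def
  by (meson order_trans)

lemma ex_solves_deterministically:
  assumes "0 < \<epsilon>"
  shows "\<exists>P. solves_deterministically P \<epsilon> (deterministic_time 7776 \<epsilon>)"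
proof (cases "\<epsilon> < 1")
  case False
  have "1 \<le> deterministic_time 7776 \<epsilon> G" for G
    using one_le_powr_log[of "nX G * nA G" "nY G * nB G" \<epsilon>] by (simp add: deterministic_time_def)
  then have "solves_deterministically Skip \<epsilon> (deterministic_time 7776 \<epsilon>)"
    using False by (auto simp: solves_deterministically_def intro!: Skip_estimates_value_within)
  then show ?thesis ..
qed (use assms deterministic_com_solves in blast)

lemma ex_solves_randomized:
  assumes "0 < \<epsilon>"
  shows "\<exists>P. solves_randomized P \<epsilon> (randomized_time 7776 \<epsilon>)"
proof (cases "\<epsilon> < 1")
  case False
  have "1 \<le> randomized_time 7776 \<epsilon> G" if "is_free_game G" for G
  proof -
    have "1 * 1 \<le> 7776 * real (nX G) * at_least_2 (nA G) powr (7776 * log 2 (at_least_2 (nY G * nB G)) / \<epsilon>\<^sup>2)"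
      using that by (intro mult_mono one_le_powr_log) (auto simp: is_free_game_def)
    then show ?thesis by (simp add: randomized_time_def)
  qed
  then have "solves_randomized Skip \<epsilon> (randomized_time 7776 \<epsilon>)"
    using False by (auto simp: solves_randomized_def intro!: Skip_estimates_value_within)
  then show ?thesis ..
qed (use assms randomized_com_solves in blast)

theorem theorem39:
  shows "(\<exists>C>0. \<forall>\<epsilon>>0. \<exists>P. solves_deterministically P \<epsilon> (quasipoly_time C \<epsilon>)) \<and>
         (\<exists>C>0. \<forall>\<epsilon>>0. \<exists>P. solves_randomized P \<epsilon> (randomized_time C \<epsilon>)) \<and>
         (\<exists>C>0. \<forall>\<epsilon>>0. \<exists>P. solves_deterministically P \<epsilon> (deterministic_time C \<epsilon>))"
\<comment> \<open>One constant serves all three bounds; the quasipolynomial one is inherited from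
  the deterministic program, as |X||A| and |Y||B| are at most the input size.\<close>
proof (intro conjI exI[of _ 7776] allI impI)
  fix \<epsilon> :: real assume "0 < \<epsilon>"
  then show "\<exists>P. solves_deterministically P \<epsilon> (quasipoly_time 7776 \<epsilon>)"
    using ex_solves_deterministically solves_deterministically_mono
      deterministic_time_le_quasipoly_time by blast
qed (auto intro: ex_solves_deterministically ex_solves_randomized)

end
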